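(* Let $G$ be a group. Let $\mathcal{T}$ be the set of finite binary trees with leaves labelled by elements of $G$, i.e. generated by $t::=g\mid t\leftarrow t$ ($g\in G$), where $\leftarrow$ is a formal binary constructor, with $|g|=g$, $|x\leftarrow y|=|x||y|^{-1}$, $g\bullet h=ghg^{-1}$ for a leaf $h\in G$, and $g\bullet(x\leftarrow y)=(g\bullet x)\leftarrow(g\bullet y)$. Then: (1) $\mathcal{T}$ is a crossed $G$-set; the relations $\varphi=\{((x,y),x\leftarrow y)\mid x,y\in\mathcal{T}\}:\mathcal{T}\otimes\mathcal{T}^*\to\mathcal{T}$ and $\psi=\{(x\leftarrow y,(x,y))\mid x,y\in\mathcal{T}\}:\mathcal{T}\to\mathcal{T}\otimes\mathcal{T}^*$ are morphisms of $\mathbf{XRel}(G)$, and $\varphi;\psi=\mathrm{id}_{\mathcal{T}\otimes\mathcal{T}^*}$. (2) $\mathcal{T}$ models the braided lambda calculus without $\eta$: interpreting a judgement $x_1,\dots,x_n\vdash M$ as the relation $[\![x_1,\dots,x_n\vdash M]\!]\subseteq\mathcal{T}^n\times\mathcal{T}$ given by $[\![x\vdash x]\!]=\{(a,a)\mid a\in\mathcal{T}\}$, $[\![\Gamma\vdash\lambda x.M]\!]=\{(\vec u,b\leftarrow a)\mid((\vec u,a),b)\in[\![\Gamma,x\vdash M]\!]\}$, $[\![\Gamma,\Delta\vdash M\,N]\!]=\{((\vec u,\vec v),b)\mid\exists a,\ (\vec u,b\leftarrow a)\in[\![\Gamma\vdash M]\!]\text{ and }(\vec v,a)\in[\![\Delta\vdash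 N]\!]\}$, $[\![x_{s(1)},\dots,x_{s(n)}\vdash[s]M]\!]=[\![s]\!];[\![x_1,\dots,x_n\vdash M]\!]$, every $r=[\![x_1,\dots,x_n\vdash M]\!]$ satisfies: $((u_1,\dots,u_n),a)\in r$ implies $|u_1|\cdots|u_n|=|a|$ and $((g\bullet u_1,\dots,g\bullet u_n),g\bullet a)\in r$ for all $g\in G$; and $M=_\beta N$ with $\Gamma\vdash M$, $\Gamma\vdash N$ implies $[\![\Gamma\vdash M]\!]=[\![\Gamma\vdash N]\!]$. (3) The model does not validate $\eta$: $[\![x\vdash\lambda y.x\,y]\!]\neq[\![x\vdash x]\!]$.
   Context: Crossed $G$-sets. A crossed $G$-set is a set $X$ with a $G$-action $\bullet$ and a map $|\_|:X\to G$ with $|g\bullet x|=g|x|g^{-1}$. $\mathbf{XRel}(G)$ is the category with crossed $G$-sets as objects, and as morphisms $X\to Y$ the relations $r\subseteq X\times Y$ such that $(x,y)\in r$ implies $|x|=|y|$ and $(g\bullet x,g\bullet y)\in r$ for all $g\in G$; composition $r;r'$ is relational composition in diagrammatic order. $X\otimes Y$ is $X\times Y$ with $g\bullet(x,y)=(g\bullet x,g\bullet y)$ and $|(x,y)|=|x||y|$. $X^*$ is $X$ with the same action and valuation $x\mapsto|x|^{-1}$. Interpretation of braids. For $s\in B_n$, $[\![s]\!]\subseteq\mathcal{T}^n\times\mathcal{T}^n$ is determined by $[\![ss']\!]=[\![s]\!];[\![s']\!]$, $[\![e]\!]=\mathrm{id}$, and $[\![\sigma_i]\!]$ (resp. $[\![\sigma_i^{-1}]\!]$)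 acting on coordinates $i,i+1$ by $\{((a,b),(|a|\bullet b,a))\}$ (resp. $\{((a,b),(b,|b|^{-1}\bullet a))\}$) and as the identity elsewhere. Braid groups. $B_n$ is the Artin braid group with generators $\sigma_1,\dots,\sigma_{n-1}$ and relations $\sigma_i\sigma_j=\sigma_j\sigma_i$ for $|i-j|\ge 2$ and $\sigma_i\sigma_{i+1}\sigma_i=\sigma_{i+1}\sigma_i\sigma_{i+1}$ ($1\le i\le n-2$); $B_0,B_1$ are trivial. The unit of $B_n$ is written $e$ or $\mathrm{id}_n$. Each $s\in B_n$ induces a permutation $i\mapsto s(i)$ of $\{1,\dots,n\}$, where $\sigma_j^{\pm1}$ induces the transposition $(j\ j{+}1)$ and $(ss')(i)=s'(s(i))$. For $s\in B_n$, $s'\in B_m$, the parallel composition $s\otimes s'\in B_{n+m}$ is $s$ on the first $n$ strands and $s'$ on the last $m$ strands (so $\sigma_j$ in $s'$ becomes $\sigma_{n+j}$). Terms. Contexts are finite lists of distinct variables; terms are taken up to renaming of bound variables. Judgements $\Gamma\vdash M$ are derived by: $x\vdash x$; if $\Gamma,x\vdash M$ then $\Gamma\vdash\lambda x.M$; if $\Gamma\vdash M$ and $\Gamma'\vdash N$ (disjoint contexts) then $\Gamma,\Gamma'\vdash M\,N$; if $x_1,\dots,x_n\vdash M$ and $s\in B_n$ then $x_{s(1)},\dots,x_{s(n)}\vdash[s]M$. Substitution on braids. For $1\le i\le n$, $m\ge0$, the map $(-)[i:=m]:B_n\to B_{n+m-1}$ (replacing the strand starting at position $i$ by $m$ parallel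 strands) is defined by $e[i:=m]=e$; $(\sigma_js)[i:=m]=\sigma_{j+m-1}(s[i:=m])$ if $i\le j-1$; $(\sigma_js)[i:=m]=\sigma_j(s[i:=m])$ if $i\ge j+2$; $(\sigma_js)[j:=m]=\sigma_{j+m-1}\cdots\sigma_{j+1}\sigma_j(s[j{+}1:=m])$ for $m\geq1$ and $=s[j{+}1:=0]$ for $m=0$; $(\sigma_js)[j{+}1:=m]=\sigma_j\sigma_{j+1}\cdots\sigma_{j+m-1}(s[j:=m])$ for $m\ge1$ and $=s[j:=0]$ for $m=0$; and the same clauses for $\sigma_j^{-1}s$ with every displayed generator replaced by its inverse (in the same order). Substitution on terms. $M[x:=N]$ is the usual capture-avoiding replacement of the unique free occurrence of $x$ on variables, abstractions and applications, and, if $x_1,\dots,x_n\vdash M$, $s\in B_n$ and $N$ has $m$ free variables, $([s]M)[x_i:=N]=\big[s[s^{-1}(i):=m]\big](M[x_i:=N])$. Equality. $=_\beta$ is the smallest congruence on terms (braids being elements of $B_n$) containing $(\lambda x.M)N=M[x:=N]$ and the structural axioms $[\mathrm{id}_n]M=M$; $[s]([s']M)=[ss']M$; $([s]M)([s']N)=[s\otimes s'](M\,N)$; $[s](\lambda x.M)=\lambda x.[s\otimes\mathrm{id}_1]M$. *)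

theory Defs
  imports "HOL-Algebra.Group_Action"
begin

section \<open>Crossed G-sets\<close>

record ('g, 'x) crossed_set =
  pts :: "'x set"
  act :: "'g \<Rightarrow> 'x \<Rightarrow> 'x"
  val :: "'x \<Rightarrow> 'g"

text \<open>The library's \<^const>\<open>group_action\<close> asks for extensional permutations of the
  underlying set, hence the \<^const>\<open>restrict\<close>.\<close>

definition crossed_G_set :: "('g, 'z) monoid_scheme \<Rightarrow> ('g, 'x) crossed_set \<Rightarrow> bool" where
  "crossed_G_set G X \<longleftrightarrow>
     group_action G (pts X) (\<lambda>g. restrict (act X g) (pts X)) \<and>
     (\<forall>x\<in>pts X. val X x \<in> carrier G) \<and>
     (\<forall>g\<in>carrier G. \<forall>x\<in>pts X. val X (act X g x) = g \<otimes>\<^bsub>G\<^esub> val X x \<otimes>\<^bsub>G\<^esub> inv\<^bsub>G\<^esub> g)"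

text \<open>Morphisms of XRel(G). Composition is \<^term>\<open>(O)\<close>, which is in diagrammatic order;
  the identity on \<open>X\<close> is \<^term>\<open>Id_on (pts X)\<close>.\<close>

definition XRel_hom ::
  "('g, 'z) monoid_scheme \<Rightarrow> ('g, 'x) crossed_set \<Rightarrow> ('g, 'y) crossed_set \<Rightarrow> ('x \<times> 'y) set set" where
  "XRel_hom G X Y = {r. crossed_G_set G X \<and> crossed_G_set G Y \<and> r \<subseteq> pts X \<times> pts Y \<and>
     (\<forall>(x, y)\<in>r. val X x = val Y y \<and> (\<forall>g\<in>carrier G. (act X g x, act Y g y) \<in> r))}"

definition crossed_tensor ::
  "('g, 'z) monoid_scheme \<Rightarrow> ('g, 'x) crossed_set \<Rightarrow> ('g, 'y) crossed_set \<Rightarrow> ('g, 'x \<times> 'y) crossed_set"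
where
  "crossed_tensor G X Y =
     \<lparr>pts = pts X \<times> pts Y,
      act = (\<lambda>g (x, y). (act X g x, act Y g y)),
      val = (\<lambda>(x, y). val X x \<otimes>\<^bsub>G\<^esub> val Y y)\<rparr>"

definition crossed_dual :: "('g, 'z) monoid_scheme \<Rightarrow> ('g, 'x) crossed_set \<Rightarrow> ('g, 'x) crossed_set" where
  "crossed_dual G X = \<lparr>pts = pts X, act = act X, val = (\<lambda>x. inv\<^bsub>G\<^esub> (val X x))\<rparr>"


section \<open>Labelled binary trees\<close>

datatype 'g tree = Leaf 'g | Node "'g tree" "'g tree"  (infixl \<open>\<leftarrow>\<close> 65)

primrec tree_val :: "('g, 'z) monoid_scheme \<Rightarrow> 'g tree \<Rightarrow> 'g" where
  "tree_val G (Leaf g) = g"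
| "tree_val G (x \<leftarrow> y) = tree_val G x \<otimes>\<^bsub>G\<^esub> inv\<^bsub>G\<^esub> (tree_val G y)"

primrec tree_act :: "('g, 'z) monoid_scheme \<Rightarrow> 'g \<Rightarrow> 'g tree \<Rightarrow> 'g tree" where
  "tree_act G g (Leaf h) = Leaf (g \<otimes>\<^bsub>G\<^esub> h \<otimes>\<^bsub>G\<^esub> inv\<^bsub>G\<^esub> g)"
| "tree_act G g (x \<leftarrow> y) = tree_act G g x \<leftarrow> tree_act G g y"

definition trees :: "('g, 'z) monoid_scheme \<Rightarrow> 'g tree set" where
  "trees G = {t. set_tree t \<subseteq> carrier G}"

definition tree_crossed :: "('g, 'z) monoid_scheme \<Rightarrow> ('g, 'g tree) crossed_set" where
  "tree_crossed G = \<lparr>pts = trees G, act = tree_act G, val = tree_val G\<rparr>"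

definition tree_phi :: "('g, 'z) monoid_scheme \<Rightarrow> (('g tree \<times> 'g tree) \<times> 'g tree) set" where
  "tree_phi G = {((x, y), x \<leftarrow> y) | x y. x \<in> trees G \<and> y \<in> trees G}"

definition tree_psi :: "('g, 'z) monoid_scheme \<Rightarrow> ('g tree \<times> ('g tree \<times> 'g tree)) set" where
  "tree_psi G = {(x \<leftarrow> y, (x, y)) | x y. x \<in> trees G \<and> y \<in> trees G}"

text \<open>Powers of the set of trees; tuples are lists.\<close>

definition tree_tuples :: "('g, 'z) monoid_scheme \<Rightarrow> nat \<Rightarrow> 'g tree list set" where
  "tree_tuples G n = {u. length u = n \<and> set u \<subseteq> trees G}"

definition tuple_val :: "('g, 'z) monoid_scheme \<Rightarrow> 'g tree list \<Rightarrow> 'g" where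
  "tuple_val G u = foldr (\<lambda>t g. tree_val G t \<otimes>\<^bsub>G\<^esub> g) u \<one>\<^bsub>G\<^esub>"


section \<open>Braid groups\<close>

text \<open>The letter \<open>(True, i)\<close> stands for \<open>\<sigma>\<^sub>i\<close> and \<open>(False, i)\<close> for its inverse.\<close>

type_synonym bword = "(bool \<times> nat) list"

definition bwords :: "nat \<Rightarrow> bword set" where
  "bwords n = {w. \<forall>(e, i)\<in>set w. 1 \<le> i \<and> i < n}"

inductive braid_eq :: "nat \<Rightarrow> bword \<Rightarrow> bword \<Rightarrow> bool" for n where
  refl: "w \<in> bwords n \<Longrightarrow> braid_eq n w w"
| sym: "braid_eq n v w \<Longrightarrow> braid_eq n w v"
| trans: "braid_eq n u v \<Longrightarrow> braid_eq n v w \<Longrightarrow> braid_eq n u w"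
| cong: "braid_eq n v v' \<Longrightarrow> braid_eq n w w' \<Longrightarrow> braid_eq n (v @ w) (v' @ w')"
| cancel: "1 \<le> i \<Longrightarrow> i < n \<Longrightarrow> braid_eq n [(e, i), (\<not> e, i)] []"
| far: "1 \<le> i \<Longrightarrow> i + 2 \<le> j \<Longrightarrow> j < n \<Longrightarrow> braid_eq n [(True, i), (True, j)] [(True, j), (True, i)]"
| artin: "1 \<le> i \<Longrightarrow> i + 1 < n \<Longrightarrow>
    braid_eq n [(True, i), (True, i + 1), (True, i)] [(True, i + 1), (True, i), (True, i + 1)]"

primrec word_perm :: "bword \<Rightarrow> nat \<Rightarrow> nat" where
  "word_perm [] i = i"
| "word_perm (l # w) i =
     word_perm w (if i = snd l then snd l + 1 else if i = snd l + 1 then snd l else i)"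

fun word_subst :: "bword \<Rightarrow> nat \<Rightarrow> nat \<Rightarrow> bword" where
  "word_subst [] i m = []"
| "word_subst ((e, j) # w) i m =
    (if i < j then (e, j + m - 1) # word_subst w i m
     else if i = j then map (Pair e) (rev [j..<j + m]) @ word_subst w (j + 1) m
     else if i = j + 1 then map (Pair e) [j..<j + m] @ word_subst w j m
     else (e, j) # word_subst w i m)"

definition word_shift :: "nat \<Rightarrow> bword \<Rightarrow> bword" where
  "word_shift n w = map (map_prod id ((+) n)) w"

lemma bwords_Nil [simp]: "[] \<in> bwords n"
  by (simp add: bwords_def)

lemma bwords_Cons [simp]: "(e, i) # w \<in> bwords n \<longleftrightarrow> 1 \<le> i \<and> i < n \<and> w \<in> bwords n"
  by (auto simp: bwords_def)

lemma bwords_append [simp]: "v @ w \<in> bwords n \<longleftrightarrow> v \<in> bwords n \<and> w \<in> bwords n"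
  by (auto simp: bwords_def)

lemma bwords_mono: "w \<in> bwords n \<Longrightarrow> n \<le> m \<Longrightarrow> w \<in> bwords m"
  by (auto simp: bwords_def)

lemma bwords_map_Pair [simp]: "map (Pair e) ks \<in> bwords n \<longleftrightarrow> (\<forall>k\<in>set ks. 1 \<le> k \<and> k < n)"
  by (auto simp: bwords_def)

lemma bwords_shift: "w \<in> bwords m \<Longrightarrow> word_shift n w \<in> bwords (n + m)"
  by (auto simp: bwords_def word_shift_def)

lemma braid_eq_bwords: "braid_eq n v w \<Longrightarrow> v \<in> bwords n \<and> w \<in> bwords n"
  by (induction rule: braid_eq.induct) auto

declare braid_eq.trans [trans]

lemma braid_eq_context:
  "braid_eq n v w \<Longrightarrow> x \<in> bwords n \<Longrightarrow> y \<in> bwords n \<Longrightarrow> braid_eq n (x @ v @ y) (x @ w @ y)"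
  by (intro braid_eq.cong braid_eq.refl)

lemma braid_eq_mono:
  "braid_eq n v w \<Longrightarrow> n \<le> m \<Longrightarrow> braid_eq m v w"
proof (induction rule: braid_eq.induct)
  case (trans u v w)
  then show ?case by (blast intro: braid_eq.trans)
next
  case (artin i)
  then show ?case by (intro braid_eq.artin) auto
qed (auto intro: braid_eq.intros bwords_mono)

lemma braid_eq_shift: "braid_eq m v w \<Longrightarrow> braid_eq (n + m) (word_shift n v) (word_shift n w)"
proof (induction rule: braid_eq.induct)
  case (refl w)
  then show ?case by (intro braid_eq.refl bwords_shift)
next
  case (sym v w)
  then show ?case by (blast intro: braid_eq.sym)
next
  case (trans u v w)
  then show ?case by (blast intro: braid_eq.trans)
next
  case (cong v v' w w')
  then show ?case using braid_eq.cong by (simp add: word_shift_def)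
next
  case (cancel i e)
  then show ?case using braid_eq.cancel[of "n + i" "n + m" e] by (simp add: word_shift_def)
next
  case (far i j)
  then show ?case using braid_eq.far[of "n + i" "n + j" "n + m"] by (simp add: word_shift_def)
next
  case (artin i)
  then show ?case using braid_eq.artin[of "n + i" "n + m"] by (simp add: word_shift_def)
qed

lemma braid_eq_rev: "braid_eq n v w \<Longrightarrow> braid_eq n (rev v) (rev w)"
proof (induction rule: braid_eq.induct)
  case (refl w)
  then show ?case by (intro braid_eq.refl) (simp add: bwords_def)
next
  case (sym v w)
  then show ?case by (blast intro: braid_eq.sym)
next
  case (trans u v w)
  then show ?case by (blast intro: braid_eq.trans)
next
  case (cong v v' w w')
  then show ?case using braid_eq.cong by simp
next
  case (cancel i e)
  then show ?case using braid_eq.cancel[of i n "\<not> e"] by simp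
next
  case (far i j)
  then show ?case using braid_eq.sym[OF braid_eq.far] by simp
next
  case (artin i)
  then show ?case using braid_eq.artin by simp
qed

lemma word_perm_append [simp]: "word_perm (v @ w) i = word_perm w (word_perm v i)"
  by (induction v arbitrary: i) auto

lemma word_perm_braid_eq: "braid_eq n v w \<Longrightarrow> word_perm v = word_perm w"
  by (induction rule: braid_eq.induct) (auto simp: fun_eq_iff)

lemma word_perm_range: "w \<in> bwords n \<Longrightarrow> i \<in> {1..n} \<Longrightarrow> word_perm w i \<in> {1..n}"
  by (induction w arbitrary: i) (auto simp: bwords_def)

lemma word_subst_append:
  "word_subst (v @ w) i m = word_subst v i m @ word_subst w (word_perm v i) m"
  by (induction v i m rule: word_subst.induct) auto

lemma word_subst_bwords:
  "w \<in> bwords n \<Longrightarrow> i \<in> {1..n} \<Longrightarrow> word_subst w i m \<in> bwords (n + m - 1)"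
  by (induction w i m rule: word_subst.induct) auto

lemma braid_eq_far':
  assumes "1 \<le> i" "1 \<le> j" "i < n" "j < n" "i + 2 \<le> j \<or> j + 2 \<le> i"
  shows "braid_eq n [(True, i), (True, j)] [(True, j), (True, i)]"
  using assms braid_eq.far[of i j n] braid_eq.sym[OF braid_eq.far[of j i n]] by auto

lemma braid_eq_far_block:
  assumes "1 \<le> c" "c < n" "\<forall>k\<in>set ks. 1 \<le> k \<and> k < n \<and> (k + 2 \<le> c \<or> c + 2 \<le> k)"
  shows "braid_eq n (map (Pair True) ks @ [(True, c)]) ((True, c) # map (Pair True) ks)"
  using assms(3)
proof (induction ks)
  case Nil
  then show ?case using assms by (auto intro: braid_eq.refl)
next
  case (Cons k ks)
  let ?K = "map (Pair True) ks"
  have K: "?K \<in> bwords n" using Cons.prems by auto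
  have "braid_eq n ([(True, k)] @ (?K @ [(True, c)])) ([(True, k)] @ ((True, c) # ?K))"
    using Cons by (intro braid_eq.cong braid_eq.refl) auto
  also have "braid_eq n ([(True, k)] @ ((True, c) # ?K)) ([(True, c), (True, k)] @ ?K)"
    using braid_eq.cong[OF braid_eq_far'[of k c n] braid_eq.refl[OF K]] Cons.prems assms by auto
  finally show ?case by simp
qed

lemma braid_eq_cancel_block:
  assumes "\<forall>k\<in>set ks. 1 \<le> k \<and> k < n"
  shows "braid_eq n (map (Pair e) ks @ map (Pair (\<not> e)) (rev ks)) []"
  using assms
proof (induction ks)
  case Nil
  then show ?case by (auto intro: braid_eq.refl)
next
  case (Cons k ks)
  have "braid_eq n ([(e, k)] @ (map (Pair e) ks @ map (Pair (\<not> e)) (rev ks)) @ [(\<not> e, k)])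
          ([(e, k)] @ [] @ [(\<not> e, k)])"
    using Cons by (intro braid_eq_context) auto
  also have "braid_eq n ([(e, k)] @ [] @ [(\<not> e, k)]) []"
    using Cons.prems braid_eq.cancel by simp
  finally show ?case by simp
qed

text \<open>A single strand crossing a cable of \<open>m\<close> strands, from the left, in the middle or from the
  right of a braid relation.\<close>

lemma braid_eq_artin_cable_right:
  assumes "1 \<le> a" "a + m < n"
  shows "braid_eq n ((True, a) # map (Pair True) ([a + 1..<a + 1 + m] @ [a..<a + m]))
           (map (Pair True) ([a + 1..<a + 1 + m] @ [a..<a + m]) @ [(True, a + m)])"
  using assms(2)
proof (induction m)
  case 0
  then show ?case using assms by (auto intro: braid_eq.refl)
next
  case (Suc m)
  let ?U = "map (Pair True) [a + 1..<a + 1 + m]"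
  let ?V = "map (Pair True) [a..<a + m]"
  let ?p = "(True, a + m)" and ?q = "(True, a + m + 1)"
  have U: "?U \<in> bwords n" and V: "?V \<in> bwords n" using Suc.prems assms by auto
  have pq: "[?p] \<in> bwords n" "[?q] \<in> bwords n" "[(True, a)] \<in> bwords n" using Suc.prems assms by auto
  have c: "braid_eq n (?V @ [?q]) (?q # ?V)"
    using Suc.prems assms braid_eq_far_block[of "a + m + 1" n "[a..<a + m]"] by auto
  have "braid_eq n (((True, a) # ?U) @ ([?q] @ ?V) @ [?p]) (((True, a) # ?U) @ (?V @ [?q]) @ [?p])"
    using c U V pq by (intro braid_eq_context braid_eq.sym[OF c[simplified]]) (auto intro: braid_eq.sym)
  also have "braid_eq n (((True, a) # ?U) @ (?V @ [?q]) @ [?p]) ((?U @ ?V @ [?p]) @ [?q, ?p])"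
    using Suc braid_eq.cong[OF Suc.IH braid_eq.refl[of "[?q, ?p]"]] pq by auto
  also have "braid_eq n ((?U @ ?V @ [?p]) @ [?q, ?p]) ((?U @ ?V) @ [?q, ?p, ?q])"
    using Suc.prems assms U V
      braid_eq.cong[OF braid_eq.refl[of "?U @ ?V"] braid_eq.artin[of "a + m" n]] by auto
  also have "braid_eq n ((?U @ ?V) @ [?q, ?p, ?q]) (?U @ (?q # ?V) @ [?p, ?q])"
    using braid_eq_context[OF c U, of "[?p, ?q]"] pq by auto
  finally show ?case by simp
qed

lemma braid_eq_artin_cable_left:
  assumes "1 \<le> a" "a + m < n"
  shows "braid_eq n (map (Pair True) (rev [a..<a + m] @ rev [a + 1..<a + 1 + m]) @ [(True, a)])
           ((True, a + m) # map (Pair True) (rev [a..<a + m] @ rev [a + 1..<a + 1 + m]))"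
  using braid_eq_rev[OF braid_eq_artin_cable_right[OF assms]] by (simp add: rev_map)

lemma braid_eq_artin_cable_middle:
  assumes "1 \<le> a" "a + m < n"
  shows "braid_eq n (map (Pair True) ([a..<a + m] @ [a + m] @ rev [a..<a + m]))
           (map (Pair True) (rev [a + 1..<a + 1 + m] @ [a] @ [a + 1..<a + 1 + m]))"
  using assms(2)
proof (induction m)
  case 0
  then show ?case using assms by (auto intro: braid_eq.refl)
next
  case (Suc m)
  let ?C = "map (Pair True) [a..<a + m]"
  let ?D = "map (Pair True) (rev [a..<a + m])"
  let ?p = "(True, a + m)" and ?q = "(True, a + m + 1)"
  have C: "?C \<in> bwords n" and D: "?D \<in> bwords n" using Suc.prems assms by auto
  have pq: "[?p] \<in> bwords n" "[?q] \<in> bwords n" using Suc.prems assms by auto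
  have c: "braid_eq n (?C @ [?q]) (?q # ?C)"
    using Suc.prems assms braid_eq_far_block[of "a + m + 1" n "[a..<a + m]"] by auto
  have d: "braid_eq n (?D @ [?q]) (?q # ?D)"
    using Suc.prems assms braid_eq_far_block[of "a + m + 1" n "rev [a..<a + m]"] by auto
  have "braid_eq n (?C @ [?p, ?q, ?p] @ ?D) (?C @ [?q, ?p, ?q] @ ?D)"
    using Suc.prems assms braid_eq_context[OF braid_eq.artin[of "a + m" n] C D] by auto
  also have "braid_eq n (?C @ [?q, ?p, ?q] @ ?D) ((?q # ?C) @ [?p] @ (?D @ [?q]))"
    using braid_eq.cong[OF c braid_eq.cong[OF braid_eq.refl[OF pq(1)] braid_eq.sym[OF d]]] by simp
  also have "braid_eq n ((?q # ?C) @ [?p] @ (?D @ [?q]))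
      ([?q] @ map (Pair True) (rev [a + 1..<a + 1 + m] @ [a] @ [a + 1..<a + 1 + m]) @ [?q])"
    using braid_eq_context[OF Suc.IH pq(2) pq(2)] Suc.prems by simp
  finally show ?case by simp
qed

lemma word_subst_braid_eq:
  "braid_eq n v w \<Longrightarrow> i \<in> {1..n} \<Longrightarrow> braid_eq (n + m - 1) (word_subst v i m) (word_subst w i m)"
proof (induction arbitrary: i rule: braid_eq.induct)
  case (refl w)
  then show ?case by (intro braid_eq.refl word_subst_bwords)
next
  case (sym v w)
  then show ?case by (blast intro: braid_eq.sym)
next
  case (trans u v w)
  then show ?case by (blast intro: braid_eq.trans)
next
  case (cong v v' w w')
  have "word_perm v i \<in> {1..n}"
    using cong.hyps cong.prems braid_eq_bwords word_perm_range by blast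
  then show ?case
    using cong word_perm_braid_eq[OF cong.hyps(1)] by (auto simp: word_subst_append intro: braid_eq.cong)
next
  case (cancel j e)
  consider "i < j" | "i = j" | "i = j + 1" | "i > j + 1" by linarith
  then show ?case
  proof cases
    case 2
    then show ?thesis
      using braid_eq_cancel_block[of "rev [j..<j + m]" "n + m - 1" e] cancel by fastforce
  next
    case 3
    then show ?thesis
      using braid_eq_cancel_block[of "[j..<j + m]" "n + m - 1" e] cancel by fastforce
  qed (use cancel in \<open>auto intro: braid_eq.cancel\<close>)
next
  case (far a b)
  let ?N = "n + m - 1"
  consider "i < a" | "i = a" | "i = a + 1" | "a + 1 < i" "i < b" | "i = b" | "i = b + 1" | "b + 1 < i"
    by linarith
  then show ?case
  proof cases
    case 2
    have "braid_eq ?N (map (Pair True) (rev [a..<a + m]) @ [(True, b + m - 1)])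
        ((True, b + m - 1) # map (Pair True) (rev [a..<a + m]))"
      using far by (intro braid_eq_far_block) auto
    then show ?thesis using 2 far by simp
  next
    case 3
    have "braid_eq ?N (map (Pair True) ([a..<a + m]) @ [(True, b + m - 1)])
        ((True, b + m - 1) # map (Pair True) ([a..<a + m]))"
      using far by (intro braid_eq_far_block) auto
    then show ?thesis using 3 far by simp
  next
    case 5
    have "braid_eq ?N (map (Pair True) (rev [b..<b + m]) @ [(True, a)])
        ((True, a) # map (Pair True) (rev [b..<b + m]))"
      using far by (intro braid_eq_far_block) auto
    then show ?thesis using 5 far by (simp add: braid_eq.sym)
  next
    case 6
    have "braid_eq ?N (map (Pair True) ([b..<b + m]) @ [(True, a)])
        ((True, a) # map (Pair True) ([b..<b + m]))"
      using far by (intro braid_eq_far_block) auto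
    then show ?thesis using 6 far by (simp add: braid_eq.sym)
  qed (use far in \<open>auto intro!: braid_eq_far'\<close>)
next
  case (artin a)
  let ?N = "n + m - 1"
  consider "i < a" | "i = a" | "i = a + 1" | "i = a + 2" | "a + 2 < i" by linarith
  then show ?case
  proof cases
    case 1
    then show ?thesis using artin braid_eq.artin[of "a + m - 1" ?N] by (simp add: Suc_diff_le)
  next
    case 2
    then show ?thesis using artin braid_eq_artin_cable_left[of a m ?N] by simp
  next
    case 3
    then show ?thesis using artin braid_eq_artin_cable_middle[of a m ?N] by simp
  next
    case 4
    then show ?thesis using artin braid_eq_artin_cable_right[of a m ?N] by simp
  next
    case 5
    then show ?thesis using artin braid_eq.artin[of a ?N] by simp
  qed
qed

text \<open>The disjoint union of all \<open>B\<^sub>n\<close>: a braid is a number of strands together with a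
  word on these strands modulo the braid relations.\<close>

quotient_type braid = "nat \<times> bword" / partial: "\<lambda>(n, v) (m, w). n = m \<and> braid_eq n v w"
proof (rule part_equivpI)
  show "\<exists>x. (\<lambda>(n, v) (m, w). n = m \<and> braid_eq n v w) x x"
    by (rule exI[of _ "(0, [])"]) (auto intro: braid_eq.refl)
qed (auto intro!: sympI transpI intro: braid_eq.sym braid_eq.trans)

lift_definition strands :: "braid \<Rightarrow> nat" is fst
  by auto

text \<open>The braid represented by a word; junk unless the word lies in \<^term>\<open>bwords n\<close>.\<close>

lift_definition braid_of :: "nat \<Rightarrow> bword \<Rightarrow> braid" is
  "\<lambda>n w. (n, if w \<in> bwords n then w else [])"
  by (auto intro: braid_eq.refl)

lift_definition braid_id :: "nat \<Rightarrow> braid" is "\<lambda>n. (n, [])"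
  by (auto intro: braid_eq.refl)

lemma braid_eq_Nil: "braid_eq n [] []"
  by (simp add: braid_eq.refl)

text \<open>Only meaningful for braids with equally many strands.\<close>

lift_definition braid_mult :: "braid \<Rightarrow> braid \<Rightarrow> braid" is
  "\<lambda>(n, v) (m, w). if n = m then (n, v @ w) else (0, [])"
  by (auto simp: braid_eq_Nil braid_eq.cong split: if_splits)

lift_definition braid_tensor :: "braid \<Rightarrow> braid \<Rightarrow> braid" is
  "\<lambda>(n, v) (m, w). (n + m, v @ word_shift n w)"
  by (auto intro!: braid_eq.cong braid_eq_shift intro: braid_eq_mono)

lift_definition braid_perm :: "braid \<Rightarrow> nat \<Rightarrow> nat" is "\<lambda>(n, w). word_perm w"
  by (auto dest: word_perm_braid_eq)

text \<open>\<open>braid_subst s i m\<close> is \<open>s[i := m]\<close>; only meaningful for \<open>1 \<le> i \<le> strands s\<close>.\<close>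

lift_definition braid_subst :: "braid \<Rightarrow> nat \<Rightarrow> nat \<Rightarrow> braid" is
  "\<lambda>(n, w) i m. if i \<in> {1..n} then (n + m - 1, word_subst w i m) else (0, [])"
  by (auto simp: braid_eq_Nil word_subst_braid_eq[simplified] split: if_splits)


section \<open>Interpretation of braids\<close>

fun gen_interp ::
  "('g, 'z) monoid_scheme \<Rightarrow> nat \<Rightarrow> bool \<times> nat \<Rightarrow> ('g tree list \<times> 'g tree list) set" where
  "gen_interp G n (True, i) =
     {(u @ [a, b] @ v, u @ [tree_act G (tree_val G a) b, a] @ v) | u a b v.
        i = length u + 1 \<and> u @ [a, b] @ v \<in> tree_tuples G n}"
| "gen_interp G n (False, i) =
     {(u @ [a, b] @ v, u @ [b, tree_act G (inv\<^bsub>G\<^esub> (tree_val G b)) a] @ v) | u a b v.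
        i = length u + 1 \<and> u @ [a, b] @ v \<in> tree_tuples G n}"

primrec word_interp ::
  "('g, 'z) monoid_scheme \<Rightarrow> nat \<Rightarrow> bword \<Rightarrow> ('g tree list \<times> 'g tree list) set" where
  "word_interp G n [] = Id_on (tree_tuples G n)"
| "word_interp G n (l # w) = gen_interp G n l O word_interp G n w"

text \<open>When \<open>G\<close> is a group, all words representing \<open>s\<close> have the same interpretation.\<close>

definition braid_interp ::
  "('g, 'z) monoid_scheme \<Rightarrow> braid \<Rightarrow> ('g tree list \<times> 'g tree list) set" where
  "braid_interp G s =
     (\<Union>w\<in>{w \<in> bwords (strands s). braid_of (strands s) w = s}. word_interp G (strands s) w)"


section \<open>Terms of the braided lambda calculus\<close>

text \<open>Raw terms with named variables; renaming of bound variables is one of the generators of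
  the equality below.\<close>

type_synonym var = nat

datatype tm =
    Var var
  | Lam var tm
  | App tm tm
  | Braid braid tm

text \<open>The list \<open>x\<^sub>s\<^sub>(\<^sub>1\<^sub>), \<dots>, x\<^sub>s\<^sub>(\<^sub>n\<^sub>)\<close>, where positions are counted from 1.\<close>

definition permute_ctx :: "braid \<Rightarrow> var list \<Rightarrow> var list" where
  "permute_ctx s xs = map (\<lambda>i. xs ! (braid_perm s i - 1)) [1..<length xs + 1]"

inductive judgement :: "var list \<Rightarrow> tm \<Rightarrow> bool"  (infix \<open>\<turnstile>\<close> 50) where
  Var: "[x] \<turnstile> Var x"
| Lam: "\<Gamma> @ [x] \<turnstile> M \<Longrightarrow> \<Gamma> \<turnstile> Lam x M"
| App: "\<Gamma> \<turnstile> M \<Longrightarrow> \<Delta> \<turnstile> N \<Longrightarrow> set \<Gamma> \<inter> set \<Delta> = {} \<Longrightarrow> \<Gamma> @ \<Delta> \<turnstile> App M N"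
| Braid: "\<Gamma> \<turnstile> M \<Longrightarrow> strands s = length \<Gamma> \<Longrightarrow> permute_ctx s \<Gamma> \<turnstile> Braid s M"

definition is_term :: "tm \<Rightarrow> bool" where
  "is_term M \<longleftrightarrow> (\<exists>\<Gamma>. \<Gamma> \<turnstile> M)"

text \<open>The context of a term: \<open>\<Gamma> \<turnstile> M\<close> implies \<open>ctx M = \<Gamma>\<close>.\<close>

primrec ctx :: "tm \<Rightarrow> var list" where
  "ctx (Var x) = [x]"
| "ctx (Lam x M) = removeAll x (ctx M)"
| "ctx (App M N) = ctx M @ ctx N"
| "ctx (Braid s M) = permute_ctx s (ctx M)"

primrec bound_vars :: "tm \<Rightarrow> var set" where
  "bound_vars (Var x) = {}"
| "bound_vars (Lam x M) = insert x (bound_vars M)"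
| "bound_vars (App M N) = bound_vars M \<union> bound_vars N"
| "bound_vars (Braid s M) = bound_vars M"

text \<open>\<open>rename x y M\<close> replaces the free occurrences of \<open>x\<close> by \<open>y\<close>; it is used for \<open>y\<close> not
  occurring in \<open>M\<close> only.\<close>

primrec rename :: "var \<Rightarrow> var \<Rightarrow> tm \<Rightarrow> tm" where
  "rename x y (Var z) = Var (if z = x then y else z)"
| "rename x y (Lam z M) = (if z = x then Lam z M else Lam z (rename x y M))"
| "rename x y (App M N) = App (rename x y M) (rename x y N)"
| "rename x y (Braid s M) = Braid s (rename x y M)"

definition position :: "var \<Rightarrow> var list \<Rightarrow> nat" where
  "position x xs = length (takeWhile (\<lambda>y. y \<noteq> x) xs) + 1"

text \<open>Replacement of the free occurrence of \<open>x\<close>. It does not rename bound variables, and is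
  used only where no capture can occur, i.e. \<^term>\<open>bound_vars M \<inter> set (ctx N) = {}\<close>.\<close>

primrec subst :: "tm \<Rightarrow> var \<Rightarrow> tm \<Rightarrow> tm" where
  "subst (Var y) x N = (if y = x then N else Var y)"
| "subst (Lam y M) x N = (if y = x then Lam y M else Lam y (subst M x N))"
| "subst (App M M') x N = App (subst M x N) (subst M' x N)"
| "subst (Braid s M) x N =
     (if x \<in> set (ctx M)
      then Braid (braid_subst s (inv_into UNIV (braid_perm s) (position x (ctx M))) (length (ctx N)))
             (subst M x N)
      else Braid s M)"

text \<open>The axioms, on raw terms. The side conditions on numbers of strands and on variables
  come from requiring both sides to be terms in \<open>beta_eq\<close>. As terms
  are considered up to \<open>alpha\<close>, the restriction of \<open>beta\<close> to representatives
  without variable capture is no restriction.\<close>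

inductive beta_axiom :: "tm \<Rightarrow> tm \<Rightarrow> bool" where
  alpha: "y \<notin> set (ctx M) \<union> bound_vars M \<Longrightarrow> beta_axiom (Lam x M) (Lam y (rename x y M))"
| beta: "bound_vars M \<inter> set (ctx N) = {} \<Longrightarrow> beta_axiom (App (Lam x M) N) (subst M x N)"
| braid_id: "beta_axiom (Braid (braid_id n) M) M"
| braid_mult: "beta_axiom (Braid s (Braid s' M)) (Braid (braid_mult s s') M)"
| braid_app: "beta_axiom (App (Braid s M) (Braid s' N)) (Braid (braid_tensor s s') (App M N))"
| braid_lam: "beta_axiom (Braid s (Lam x M)) (Lam x (Braid (braid_tensor s (braid_id 1)) M))"

inductive beta_eq :: "tm \<Rightarrow> tm \<Rightarrow> bool"  (infix \<open>=\<^sub>\<beta>\<close> 50) where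
  ax: "beta_axiom M N \<Longrightarrow> is_term M \<Longrightarrow> is_term N \<Longrightarrow> M =\<^sub>\<beta> N"
| refl: "is_term M \<Longrightarrow> M =\<^sub>\<beta> M"
| sym: "M =\<^sub>\<beta> N \<Longrightarrow> N =\<^sub>\<beta> M"
| trans: "L =\<^sub>\<beta> M \<Longrightarrow> M =\<^sub>\<beta> N \<Longrightarrow> L =\<^sub>\<beta> N"
| Lam: "M =\<^sub>\<beta> N \<Longrightarrow> is_term (Lam x M) \<Longrightarrow> is_term (Lam x N) \<Longrightarrow> Lam x M =\<^sub>\<beta> Lam x N"
| App: "M =\<^sub>\<beta> M' \<Longrightarrow> N =\<^sub>\<beta> N' \<Longrightarrow> is_term (App M N) \<Longrightarrow> is_term (App M' N') \<Longrightarrow>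
    App M N =\<^sub>\<beta> App M' N'"
| Braid: "M =\<^sub>\<beta> N \<Longrightarrow> is_term (Braid s M) \<Longrightarrow> is_term (Braid s N) \<Longrightarrow> Braid s M =\<^sub>\<beta> Braid s N"


section \<open>Interpretation of terms\<close>

text \<open>The interpretation of \<open>\<Gamma> \<turnstile> M\<close>. A term has at most one derivation, whose context it
  determines, so recursion on the term is recursion on the judgement.\<close>

primrec interp :: "('g, 'z) monoid_scheme \<Rightarrow> tm \<Rightarrow> ('g tree list \<times> 'g tree) set" where
  "interp G (Var x) = {([a], a) | a. a \<in> trees G}"
| "interp G (Lam x M) = {(u, b \<leftarrow> a) | u a b. (u @ [a], b) \<in> interp G M}"
| "interp G (App M N) =
     {(u @ v, b) | u v b. \<exists>a. (u, b \<leftarrow> a) \<in> interp G M \<and> (v, a) \<in> interp G N}"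
| "interp G (Braid s M) = braid_interp G s O interp G M"

end

(* A braid word acts on tuples of trees by a bijection that preserves the valuation and commutes
   with G, and the braid relations hold for these bijections. The action is natural: cabling the
   strand i of a braid and then applying a morphism R on the m parallel strands is the same as
   applying R first and then the braid, because a tuple v and a tree a related by R have equal
   valuations (needed when the cable crosses over) and R is invariant under G (needed when it is
   crossed over). Hence the interpretation of M[x := N] is that of M precomposed with that of N at
   the position of x, which is the interpretation of (\<lambda>x. M) N as Node is injective. The
   interpretation ignores variable names, so capture plays no role. Eta fails because an abstraction
   only relates to nodes, whereas a variable also relates to leaves. *)

theory Submission
  imports Defs
begin

section \<open>Trees and tuples\<close>

lemma trees_Leaf [simp]: "Leaf g \<in> trees G \<longleftrightarrow> g \<in> carrier G"
  by (simp add: trees_def)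

lemma trees_Node [simp]: "x \<leftarrow> y \<in> trees G \<longleftrightarrow> x \<in> trees G \<and> y \<in> trees G"
  by (auto simp: trees_def)

lemma tree_tuples_append:
  "u @ v \<in> tree_tuples G n \<longleftrightarrow>
     length u + length v = n \<and> set u \<subseteq> trees G \<and> set v \<subseteq> trees G"
  by (auto simp: tree_tuples_def)

lemma tree_tuplesD:
  "u \<in> tree_tuples G n \<Longrightarrow> length u = n" "u \<in> tree_tuples G n \<Longrightarrow> set u \<subseteq> trees G"
  by (auto simp: tree_tuples_def)

lemma tuple_val_Nil [simp]: "tuple_val G [] = \<one>\<^bsub>G\<^esub>"
  by (simp add: tuple_val_def)

lemma tuple_val_Cons [simp]: "tuple_val G (t # u) = tree_val G t \<otimes>\<^bsub>G\<^esub> tuple_val G u"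
  by (simp add: tuple_val_def)

context group
begin

lemma tree_val_closed [simp, intro]: "t \<in> trees G \<Longrightarrow> tree_val G t \<in> carrier G"
  by (induction t) auto

lemma tree_act_closed [simp, intro]:
  "g \<in> carrier G \<Longrightarrow> t \<in> trees G \<Longrightarrow> tree_act G g t \<in> trees G"
  by (induction t) auto

lemma tree_act_one [simp]: "t \<in> trees G \<Longrightarrow> tree_act G \<one> t = t"
  by (induction t) auto

lemma tree_act_mult:
  "g \<in> carrier G \<Longrightarrow> h \<in> carrier G \<Longrightarrow> t \<in> trees G \<Longrightarrow>
     tree_act G (g \<otimes> h) t = tree_act G g (tree_act G h t)"
  by (induction t) (auto simp: m_assoc inv_mult_group)

lemma tree_act_inv [simp]:
  assumes "g \<in> carrier G" "t \<in> trees G"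
  shows "tree_act G g (tree_act G (inv g) t) = t" "tree_act G (inv g) (tree_act G g t) = t"
  using assms by (simp_all flip: tree_act_mult)

text \<open>Conjugation by \<open>g\<close> is an automorphism of the group. With
  \<open>conj_inv\<close> this settles the node case of \<open>tree_val_act\<close> and the
  valuation axiom of the tensor with the dual.\<close>

lemma conj_mult:
  assumes "g \<in> carrier G" "x \<in> carrier G" "y \<in> carrier G"
  shows "(g \<otimes> x \<otimes> inv g) \<otimes> (g \<otimes> y \<otimes> inv g) = g \<otimes> (x \<otimes> y) \<otimes> inv g"
proof -
  have "inv g \<otimes> (g \<otimes> (y \<otimes> inv g)) = y \<otimes> inv g"
    using assms by (simp flip: m_assoc)
  then show ?thesis using assms by (simp add: m_assoc)
qed

lemma conj_inv:
  assumes "g \<in> carrier G" "x \<in> carrier G"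
  shows "inv (g \<otimes> x \<otimes> inv g) = g \<otimes> inv x \<otimes> inv g"
  using assms by (simp add: m_assoc inv_mult_group)

lemma tree_val_act [simp]:
  "g \<in> carrier G \<Longrightarrow> t \<in> trees G \<Longrightarrow> tree_val G (tree_act G g t) = g \<otimes> tree_val G t \<otimes> inv g"
  by (induction t) (auto simp: conj_inv conj_mult)

text \<open>The crossed axiom makes the braiding equivariant: the value of the moved
  \<open>a\<close> is a conjugate by \<open>g\<close>, and the factor \<open>inv g\<close> at its
  end cancels against the \<open>g\<close> that moved \<open>b\<close>.\<close>

lemma tree_act_val_act:
  assumes "g \<in> carrier G" "a \<in> trees G" "b \<in> trees G"
  shows "tree_act G (tree_val G (tree_act G g a)) (tree_act G g b) =
           tree_act G g (tree_act G (tree_val G a) b)"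
    and "tree_act G (inv (tree_val G (tree_act G g a))) (tree_act G g b) =
           tree_act G g (tree_act G (inv (tree_val G a)) b)"
proof -
  have "tree_act G (g \<otimes> h \<otimes> inv g) (tree_act G g b) = tree_act G g (tree_act G h b)"
    if "h \<in> carrier G" for h
    using assms that by (simp add: tree_act_mult)
  then show "tree_act G (tree_val G (tree_act G g a)) (tree_act G g b) =
           tree_act G g (tree_act G (tree_val G a) b)"
    and "tree_act G (inv (tree_val G (tree_act G g a))) (tree_act G g b) =
           tree_act G g (tree_act G (inv (tree_val G a)) b)"
    using assms by (simp_all add: conj_inv)
qed

lemma tuple_val_closed [simp, intro]: "set u \<subseteq> trees G \<Longrightarrow> tuple_val G u \<in> carrier G"
  by (induction u) auto

lemma tuple_val_append [simp]:
  "set u \<subseteq> trees G \<Longrightarrow> set v \<subseteq> trees G \<Longrightarrow>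
     tuple_val G (u @ v) = tuple_val G u \<otimes> tuple_val G v"
  by (induction u) (auto simp: m_assoc)

lemma tuple_act_closed: "g \<in> carrier G \<Longrightarrow> u \<in> tree_tuples G n \<Longrightarrow> map (tree_act G g) u \<in> tree_tuples G n"
  by (auto simp: tree_tuples_def)

section \<open>Crossed sets\<close>

text \<open>Replaces a homomorphism into the group of extensional bijections by pointwise action
  laws; bijectivity comes from the action of \<open>inv g\<close>, which undoes that of
  \<open>g\<close>.\<close>

lemma crossed_G_setI:
  assumes act: "\<And>g x. g \<in> carrier G \<Longrightarrow> x \<in> pts X \<Longrightarrow> act X g x \<in> pts X"
    and one: "\<And>x. x \<in> pts X \<Longrightarrow> act X \<one> x = x"
    and mult: "\<And>g h x. g \<in> carrier G \<Longrightarrow> h \<in> carrier G \<Longrightarrow> x \<in> pts X \<Longrightarrow>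
                 act X (g \<otimes> h) x = act X g (act X h x)"
    and val: "\<And>x. x \<in> pts X \<Longrightarrow> val X x \<in> carrier G"
    and conj: "\<And>g x. g \<in> carrier G \<Longrightarrow> x \<in> pts X \<Longrightarrow>
                 val X (act X g x) = g \<otimes> val X x \<otimes> inv g"
  shows "crossed_G_set G X"
proof -
  let ?f = "\<lambda>g. restrict (act X g) (pts X)"
  have "bij_betw (?f g) (pts X) (pts X)" if g: "g \<in> carrier G" for g
  proof (rule bij_betwI)
    show "?f (inv g) (?f g x) = x" if "x \<in> pts X" for x
      using g that act by (simp add: one flip: mult)
    show "?f g (?f (inv g) x) = x" if "x \<in> pts X" for x
      using g that act by (simp add: one flip: mult)
  qed (use g act in auto)
  moreover have "?f (g \<otimes> h) = compose (pts X) (?f g) (?f h)"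
    if "g \<in> carrier G" "h \<in> carrier G" for g h
    using that act mult by (auto simp: compose_def restrict_def fun_eq_iff)
  ultimately have "?f \<in> hom G (BijGroup (pts X))"
    by (auto intro!: homI simp: BijGroup_def Bij_def)
  then have "group_action G (pts X) ?f"
    by (simp add: group_action_def group_hom_def group_hom_axioms_def group_BijGroup is_group)
  then show ?thesis using val conj by (simp add: crossed_G_set_def)
qed

lemma crossed_tree: "crossed_G_set G (tree_crossed G)"
  by (rule crossed_G_setI) (auto simp: tree_crossed_def tree_act_mult)

lemma crossed_tree_tensor_dual:
  "crossed_G_set G (crossed_tensor G (tree_crossed G) (crossed_dual G (tree_crossed G)))"
  by (rule crossed_G_setI)
    (auto simp: crossed_tensor_def crossed_dual_def tree_crossed_def tree_act_mult conj_inv conj_mult)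

lemma tree_phi_hom:
  "tree_phi G \<in> XRel_hom G (crossed_tensor G (tree_crossed G) (crossed_dual G (tree_crossed G)))
     (tree_crossed G)"
  using crossed_tree crossed_tree_tensor_dual
  by (auto simp: XRel_hom_def tree_phi_def crossed_tensor_def crossed_dual_def tree_crossed_def)

lemma tree_psi_hom:
  "tree_psi G \<in> XRel_hom G (tree_crossed G)
     (crossed_tensor G (tree_crossed G) (crossed_dual G (tree_crossed G)))"
  using crossed_tree crossed_tree_tensor_dual
  by (auto simp: XRel_hom_def tree_psi_def crossed_tensor_def crossed_dual_def tree_crossed_def)

lemma tree_phi_psi:
  "tree_phi G O tree_psi G =
     Id_on (pts (crossed_tensor G (tree_crossed G) (crossed_dual G (tree_crossed G))))"
  by (auto simp: tree_phi_def tree_psi_def crossed_tensor_def crossed_dual_def tree_crossed_def)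

end

section \<open>Braid words as maps on tuples\<close>

text \<open>The function whose graph \<open>gen_interp\<close> is, by \<open>gen_interp_eq\<close>.
  Strands count from 1 and list entries from 0, so the letter \<open>i\<close> changes the entries
  \<open>i - 1\<close> and \<open>i\<close>; all values on the right are read from the original
  \<open>u\<close>.\<close>

fun gen_map :: "('g, 'z) monoid_scheme \<Rightarrow> bool \<times> nat \<Rightarrow> 'g tree list \<Rightarrow> 'g tree list" where
  "gen_map G (True, i) u = u[i - 1 := tree_act G (tree_val G (u ! (i - 1))) (u ! i), i := u ! (i - 1)]"
| "gen_map G (False, i) u =
     u[i - 1 := u ! i, i := tree_act G (inv\<^bsub>G\<^esub> (tree_val G (u ! i))) (u ! (i - 1))]"

primrec word_map :: "('g, 'z) monoid_scheme \<Rightarrow> bword \<Rightarrow> 'g tree list \<Rightarrow> 'g tree list" where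
  "word_map G [] u = u"
| "word_map G (l # w) u = word_map G w (gen_map G l u)"

lemma length_gen_map [simp]: "length (gen_map G l u) = length u"
  by (cases "(G, l, u)" rule: gen_map.cases) auto

lemma length_word_map [simp]: "length (word_map G w u) = length u"
  by (induction w arbitrary: u) auto

lemma word_map_append [simp]: "word_map G (v @ w) u = word_map G w (word_map G v u)"
  by (induction v arbitrary: u) auto

lemma gen_map_append1:
  assumes "1 \<le> i"
  shows "gen_map G (e, length p + i) (p @ u) = p @ gen_map G (e, i) u"
  using assms by (cases e) (auto simp: nth_append list_update_append)

lemma gen_map_append2:
  assumes "1 \<le> i" "i < length u"
  shows "gen_map G (e, i) (u @ q) = gen_map G (e, i) u @ q"
  using assms by (cases e) (auto simp: nth_append list_update_append)

lemma gen_map_append: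
  "gen_map G (True, Suc (length p)) (p @ a # b # q) = p @ tree_act G (tree_val G a) b # a # q"
  "gen_map G (False, Suc (length p)) (p @ a # b # q) =
     p @ b # tree_act G (inv\<^bsub>G\<^esub> (tree_val G b)) a # q"
  by (simp_all add: nth_append list_update_append)

text \<open>Locality on the left. With \<open>word_map_append2\<close>, its counterpart on the
  right, it confines a computation to the strands that move: three for the Artin relation, a block
  for a cable, one factor for a parallel composition.\<close>

lemma word_map_shift:
  "\<forall>(e, i)\<in>set w. 1 \<le> i \<Longrightarrow> word_map G (word_shift (length p) w) (p @ u) = p @ word_map G w u"
  by (induction w arbitrary: u)
    (auto simp: word_shift_def gen_map_append1 simp del: gen_map.simps)

lemma word_map_append2:
  "w \<in> bwords (length u) \<Longrightarrow> word_map G w (u @ q) = word_map G w u @ q"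
  by (induction w arbitrary: u) (auto simp: bwords_def gen_map_append2 simp del: gen_map.simps)

text \<open>Turns a position into a list pattern, so that \<open>gen_map_append\<close> computes a
  crossing without index arithmetic.\<close>

lemma split_at_pair:
  assumes "u \<in> tree_tuples G n" "1 \<le> i" "i < n"
  obtains p a b q where "u = p @ a # b # q" "i = Suc (length p)"
    "set p \<subseteq> trees G" "a \<in> trees G" "b \<in> trees G" "set q \<subseteq> trees G"
proof -
  have "u = take (i - 1) u @ u ! (i - 1) # u ! i # drop (Suc i) u" "i = Suc (length (take (i - 1) u))"
    using assms tree_tuplesD(1)[OF assms(1)]
    by (metis Cons_nth_drop_Suc Suc_diff_1 Suc_lessD append_take_drop_id less_le_trans zero_less_one)
      (use assms tree_tuplesD(1)[OF assms(1)] in simp)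
  then show ?thesis using that tree_tuplesD(2)[OF assms(1)]
    by (metis Un_subset_iff insert_subset list.simps(15) set_append)
qed

lemma gen_interp_eq:
  assumes "1 \<le> i" "i < n"
  shows "gen_interp G n (e, i) = {(u, gen_map G (e, i) u) | u. u \<in> tree_tuples G n}"
proof -
  have "gen_interp G n (e, i) \<subseteq> {(u, gen_map G (e, i) u) | u. u \<in> tree_tuples G n}"
    by (cases e) (auto simp: nth_append list_update_append)
  moreover have "(u, gen_map G (e, i) u) \<in> gen_interp G n (e, i)" if u: "u \<in> tree_tuples G n" for u
  proof -
    obtain p a b q where s: "u = p @ a # b # q" "i = Suc (length p)"
      using split_at_pair[OF u assms] by metis
    then show ?thesis using u
      by (cases e; simp only: s gen_map_append gen_interp.simps mem_Collect_eq)
        (rule exI[of _ p], rule exI[of _ a], rule exI[of _ b], rule exI[of _ q], simp)+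
  qed
  ultimately show ?thesis by blast
qed

section \<open>Words acting on tuples: valuation, equivariance, braid relations\<close>

context group
begin

lemma gen_map_closed:
  assumes "1 \<le> i" "i < n" "u \<in> tree_tuples G n"
  shows "gen_map G (e, i) u \<in> tree_tuples G n"
proof -
  obtain p a b q where "u = p @ a # b # q" "i = Suc (length p)"
    using split_at_pair[OF assms(3,1,2)] by metis
  then show ?thesis using assms(3)
    by (cases e) (auto simp: gen_map_append tree_tuples_append simp del: gen_map.simps)
qed

lemma word_map_closed: "w \<in> bwords n \<Longrightarrow> u \<in> tree_tuples G n \<Longrightarrow> word_map G w u \<in> tree_tuples G n"
  by (induction w arbitrary: u) (auto simp: bwords_def gen_map_closed simp del: gen_map.simps)

lemma word_interp_eq:
  "w \<in> bwords n \<Longrightarrow> word_interp G n w = {(u, word_map G w u) | u. u \<in> tree_tuples G n}"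
proof (induction w)
  case (Cons l w)
  obtain e i where l: "l = (e, i)" by (cases l)
  then have i: "1 \<le> i" "i < n" and w: "w \<in> bwords n" using Cons.prems by auto
  show ?case
    using Cons.IH[OF w] gen_interp_eq[OF i, of G e] gen_map_closed[OF i, of _ e]
    by (auto simp: l relcomp_unfold simp del: gen_map.simps gen_interp.simps)
qed auto

text \<open>For a positive crossing \<open>|a||b||a|^-1 |a| = |a||b|\<close>, and for a negative one
  \<open>|b| |b|^-1|a||b| = |a||b|\<close>.\<close>

lemma gen_map_val:
  assumes "1 \<le> i" "i < n" "u \<in> tree_tuples G n"
  shows "tuple_val G (gen_map G (e, i) u) = tuple_val G u"
proof -
  obtain p a b q where u: "u = p @ a # b # q" "i = Suc (length p)"
    using split_at_pair[OF assms(3,1,2)] by metis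
  then have t: "set p \<subseteq> trees G" "a \<in> trees G" "b \<in> trees G" "set q \<subseteq> trees G"
    using assms(3) by (auto simp: tree_tuples_def)
  \<comment> \<open>Both identities carry the value of the tail \<open>q\<close>, which is how the
    products come out of unfolding \<open>tuple_val_Cons\<close>.\<close>
  have "tree_val G a \<otimes> tree_val G b \<otimes> inv (tree_val G a) \<otimes> (tree_val G a \<otimes> tuple_val G q) =
      tree_val G a \<otimes> (tree_val G b \<otimes> tuple_val G q)"
    using t by (simp add: m_assoc) (simp flip: m_assoc)
  moreover have "tree_val G b \<otimes> (inv (tree_val G b) \<otimes> tree_val G a \<otimes> inv (inv (tree_val G b)) \<otimes> tuple_val G q) =
      tree_val G a \<otimes> (tree_val G b \<otimes> tuple_val G q)"
    using t by (simp flip: m_assoc)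
  ultimately show ?thesis using t
    by (cases e) (auto simp: u gen_map_append simp del: gen_map.simps)
qed

lemma word_map_val: "w \<in> bwords n \<Longrightarrow> u \<in> tree_tuples G n \<Longrightarrow> tuple_val G (word_map G w u) = tuple_val G u"
  by (induction w arbitrary: u)
    (auto simp: bwords_def gen_map_closed gen_map_val simp del: gen_map.simps)

lemma gen_map_act:
  assumes "1 \<le> i" "i < n" "u \<in> tree_tuples G n" "g \<in> carrier G"
  shows "gen_map G (e, i) (map (tree_act G g) u) = map (tree_act G g) (gen_map G (e, i) u)"
proof -
  obtain p a b q where u: "u = p @ a # b # q" "i = Suc (length p)"
    using split_at_pair[OF assms(3,1,2)] by metis
  then have t: "a \<in> trees G" "b \<in> trees G"
    using assms(3) by (auto simp: tree_tuples_def)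
  show ?thesis
    using gen_map_append[of G "map (tree_act G g) p" "tree_act G g a" "tree_act G g b" "map (tree_act G g) q"]
    by (cases e) (simp_all add: u t assms(4) gen_map_append tree_act_val_act del: gen_map.simps tree_val_act)
qed

lemma word_map_act:
  "w \<in> bwords n \<Longrightarrow> u \<in> tree_tuples G n \<Longrightarrow> g \<in> carrier G \<Longrightarrow>
     word_map G w (map (tree_act G g) u) = map (tree_act G g) (word_map G w u)"
  by (induction w arbitrary: u)
    (auto simp: bwords_def gen_map_closed gen_map_act simp del: gen_map.simps)

text \<open>Induction on the derivation of the braid equality. Cancelling pairs are computed on the
  two strands concerned, and far letters touch disjoint entries.\<close>

lemma word_map_braid_eq:
  "braid_eq n v w \<Longrightarrow> u \<in> tree_tuples G n \<Longrightarrow> word_map G v u = word_map G w u"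
proof (induction arbitrary: u rule: braid_eq.induct)
  case (cong v v' w w')
  then show ?case using word_map_closed braid_eq_bwords[OF cong.hyps(1)] by simp
next
  case (cancel i e)
  obtain p a b q where u: "u = p @ a # b # q" "i = Suc (length p)"
    using split_at_pair[OF cancel.prems cancel.hyps] by metis
  then have t: "a \<in> trees G" "b \<in> trees G"
    using cancel.prems by (auto simp: tree_tuples_def)
  show ?case using t
    by (cases e) (auto simp: u gen_map_append tree_act_mult m_assoc simp del: gen_map.simps)
next
  case (far i j)
  have "length u = n" using far.prems tree_tuplesD by blast
  then show ?case using far.hyps
    by (auto intro!: nth_equalityI simp: nth_list_update)
next
  case (artin i)
  have "length u = n" using artin.prems tree_tuplesD by blast
  then obtain p a b q where 1: "u = p @ a # b # q" "i = Suc (length p)"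
    using split_at_pair[OF artin.prems] artin.hyps by (metis add_lessD1)
  then obtain c r where q: "q = c # r"
    using \<open>length u = n\<close> artin.hyps by (cases q) auto
  have u: "u = p @ [a, b, c] @ r" using 1 q by simp
  then have t: "a \<in> trees G" "b \<in> trees G" "c \<in> trees G"
    using artin.prems by (auto simp: tree_tuples_def)
  let ?v = "[(True, 1), (True, 2), (True, 1)]" and ?w = "[(True, 2), (True, 1), (True, 2)]"
  \<comment> \<open>Three strands suffice. Both words put first the tree \<open>c\<close> acted on
    by \<open>|a||b|\<close>, then \<open>b\<close> acted on by \<open>|a|\<close>, then
    \<open>a\<close>; on the left, this uses that the value of the moved \<open>b\<close> is
    \<open>|a||b||a|^-1\<close>.\<close>
  have "word_map G ?v [a, b, c] = word_map G ?w [a, b, c]"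
    using t by (simp add: numeral_2_eq_2 tree_act_mult)
  then have "word_map G (word_shift (length p) ?v) u = word_map G (word_shift (length p) ?w) u"
    unfolding u by (subst (1 2) word_map_shift)
      (simp_all add: word_map_append2[of _ "[a, b, c]"] del: word_map.simps append_Cons append_Nil)
  then show ?case by (simp add: word_shift_def 1)
qed auto

end

section \<open>Cabling\<close>

lemma upt_shift: "map ((+) n) [1..<1 + m] = [Suc n..<Suc n + m]"
  by (induction m) auto

text \<open>These blocks are what \<open>word_subst\<close> puts in place of a crossing of the
  cabled strand. They are moved to start at position 1, where the cable lemmas compute them.\<close>

lemma word_map_block:
  assumes "length u = m + 1"
  shows "word_map G (map (Pair e) (rev [Suc (length p)..<Suc (length p) + m])) (p @ u @ q) =
           p @ word_map G (map (Pair e) (rev [1..<1 + m])) u @ q"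
    and "word_map G (map (Pair e) [Suc (length p)..<Suc (length p) + m]) (p @ u @ q) =
           p @ word_map G (map (Pair e) [1..<1 + m]) u @ q"
proof -
  have *: "word_map G (map (Pair e) (map ((+) (length p)) ks)) (p @ u @ q) =
      p @ word_map G (map (Pair e) ks) u @ q" if "\<forall>k\<in>set ks. 1 \<le> k \<and> k < length u" for ks
  proof -
    have "map (Pair e) (map ((+) (length p)) ks) = word_shift (length p) (map (Pair e) ks)"
      by (simp add: word_shift_def)
    moreover have "map (Pair e) ks \<in> bwords (length u)" using that by auto
    ultimately show ?thesis using that by (simp add: word_map_shift word_map_append2)
  qed
  show "word_map G (map (Pair e) (rev [Suc (length p)..<Suc (length p) + m])) (p @ u @ q) =
           p @ word_map G (map (Pair e) (rev [1..<1 + m])) u @ q"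
    using *[of "rev [1..<1 + m]"] assms unfolding upt_shift[symmetric] rev_map by auto
  show "word_map G (map (Pair e) [Suc (length p)..<Suc (length p) + m]) (p @ u @ q) =
           p @ word_map G (map (Pair e) [1..<1 + m]) u @ q"
    using *[of "[1..<1 + m]"] assms unfolding upt_shift[symmetric] by auto
qed

text \<open>\<open>R\<close> is a morphism of XRel(G) from the \<open>m\<close>-th tensor power of the trees to the trees.\<close>

definition tuple_hom :: "('g, 'z) monoid_scheme \<Rightarrow> nat \<Rightarrow> ('g tree list \<times> 'g tree) set \<Rightarrow> bool" where
  "tuple_hom G m R \<longleftrightarrow> R \<subseteq> tree_tuples G m \<times> trees G \<and>
     (\<forall>(u, a)\<in>R. tuple_val G u = tree_val G a \<and>
        (\<forall>g\<in>carrier G. (map (tree_act G g) u, tree_act G g a) \<in> R))"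

lemma tuple_homD:
  assumes "tuple_hom G m R" "(u, a) \<in> R"
  shows "length u = m" "set u \<subseteq> trees G" "u \<in> tree_tuples G m" "a \<in> trees G"
    "tuple_val G u = tree_val G a"
    "g \<in> carrier G \<Longrightarrow> (map (tree_act G g) u, tree_act G g a) \<in> R"
  using assms by (auto simp: tuple_hom_def tree_tuples_def)

lemma tuple_homI:
  assumes "\<And>u a. (u, a) \<in> R \<Longrightarrow> u \<in> tree_tuples G m \<and> a \<in> trees G \<and>
      tuple_val G u = tree_val G a \<and>
      (\<forall>g\<in>carrier G. (map (tree_act G g) u, tree_act G g a) \<in> R)"
  shows "tuple_hom G m R"
  using assms by (auto simp: tuple_hom_def)

text \<open>The relation \<open>id\<^sup>i\<^sup>-\<^sup>1 \<otimes> R \<otimes> id\<^sup>n\<^sup>-\<^sup>i\<close>; precomposition with it interprets substitution.\<close>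

definition graft ::
  "('g, 'z) monoid_scheme \<Rightarrow> nat \<Rightarrow> ('g tree list \<times> 'g tree) set \<Rightarrow> nat \<Rightarrow>
     ('g tree list \<times> 'g tree list) set" where
  "graft G n R i = {(p @ v @ q, p @ a # q) | p v a q.
     i = Suc (length p) \<and> (v, a) \<in> R \<and> p @ a # q \<in> tree_tuples G n}"

lemma graftI:
  "i = Suc (length p) \<Longrightarrow> (v, a) \<in> R \<Longrightarrow> p @ a # q \<in> tree_tuples G n \<Longrightarrow>
     (p @ v @ q, p @ a # q) \<in> graft G n R i"
  by (auto simp: graft_def)

lemma graft_tuples:
  assumes "tuple_hom G m R" "(x, y) \<in> graft G n R i"
  shows "x \<in> tree_tuples G (n + m - 1)" "y \<in> tree_tuples G n"
proof -
  obtain p v a q where *: "x = p @ v @ q" "y = p @ a # q" "(v, a) \<in> R" "p @ a # q \<in> tree_tuples G n"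
    using assms(2) unfolding graft_def by blast
  then show "x \<in> tree_tuples G (n + m - 1)" "y \<in> tree_tuples G n"
    using tuple_homD(1,2)[OF assms(1) *(3)] by (auto simp: tree_tuples_append)
qed

section \<open>Inverse words\<close>

definition word_inv :: "bword \<Rightarrow> bword" where
  "word_inv w = rev (map (apfst Not) w)"

lemma word_inv_inv [simp]: "word_inv (word_inv w) = w"
  by (simp add: word_inv_def rev_map o_def apfst_def map_prod.compositionality prod.map_ident)

lemma word_inv_bwords [simp]: "word_inv w \<in> bwords n \<longleftrightarrow> w \<in> bwords n"
  by (force simp: word_inv_def bwords_def)

text \<open>Cancellation proceeds from the inside: the induction hypothesis removes
  \<open>w @ word_inv w\<close>, after which the outer letter meets its inverse.\<close>

lemma braid_eq_inv_right: "w \<in> bwords n \<Longrightarrow> braid_eq n (w @ word_inv w) []"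
proof (induction w)
  case (Cons l w)
  obtain e i where l: "l = (e, i)" by (cases l)
  then have i: "1 \<le> i" "i < n" and w: "w \<in> bwords n" using Cons.prems by auto
  have "braid_eq n ([(e, i)] @ (w @ word_inv w) @ [(\<not> e, i)]) ([(e, i)] @ [] @ [(\<not> e, i)])"
    using Cons.IH[OF w] i by (intro braid_eq_context) auto
  also have "braid_eq n ([(e, i)] @ [] @ [(\<not> e, i)]) []"
    using i braid_eq.cancel by simp
  finally show ?case by (simp add: l word_inv_def)
qed (simp add: word_inv_def braid_eq_Nil)

lemma braid_eq_inv_left: "w \<in> bwords n \<Longrightarrow> braid_eq n (word_inv w @ w) []"
  using braid_eq_inv_right[of "word_inv w" n] by simp

lemma word_perm_inv [simp]:
  assumes "w \<in> bwords n"
  shows "word_perm (word_inv w) (word_perm w i) = i" "word_perm w (word_perm (word_inv w) i) = i"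
  using word_perm_braid_eq[OF braid_eq_inv_right[OF assms]]
    word_perm_braid_eq[OF braid_eq_inv_left[OF assms]]
  by (metis word_perm_append word_perm.simps(1))+

section \<open>Naturality of the braid action under cabling\<close>

context group
begin

text \<open>The strand \<open>b\<close> passes the cable \<open>v\<close> from right to left,
  meeting the last strand of \<open>v\<close> first. In positive crossings it is acted on by every
  strand, and these values multiply to \<open>tuple_val G v\<close>; in negative ones it acts on
  each strand by its inverse value.\<close>

lemma word_map_cable_left:
  assumes "set v \<subseteq> trees G" "b \<in> trees G"
  shows "word_map G (map (Pair True) (rev [1..<1 + length v])) (v @ [b]) =
           tree_act G (tuple_val G v) b # v"
    and "word_map G (map (Pair False) (rev [1..<1 + length v])) (v @ [b]) =
           b # map (tree_act G (inv (tree_val G b))) v"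
proof -
  \<comment> \<open>Once \<open>b\<close> has passed the last strand of the cable, the rest of the
    block leaves the last entry alone.\<close>
  have *: "word_map G (map (Pair e) (rev [1..<1 + length v])) ((v @ [b]) @ [c]) =
      word_map G (map (Pair e) (rev [1..<1 + length v])) (v @ [b]) @ [c]" for e b c and v :: "'a tree list"
    by (rule word_map_append2) auto
  show "word_map G (map (Pair True) (rev [1..<1 + length v])) (v @ [b]) =
           tree_act G (tuple_val G v) b # v"
    using assms
  \<comment> \<open>\<open>b\<close> is generalized because it reaches the rest of the cable only
    after being acted on by \<open>tree_val G c\<close>.\<close>
  proof (induction v arbitrary: b rule: rev_induct)
    case (snoc c v)
    then show ?case
      using *[of True v "tree_act G (tree_val G c) b" c] gen_map_append(1)[of G v c b "[]"]
      by (simp add: tree_act_mult del: gen_map.simps)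
  qed auto
  show "word_map G (map (Pair False) (rev [1..<1 + length v])) (v @ [b]) =
           b # map (tree_act G (inv (tree_val G b))) v"
    using assms
  proof (induction v rule: rev_induct)
    case (snoc c v)
    then show ?case
      using *[of False v b "tree_act G (inv (tree_val G b)) c"] gen_map_append(2)[of G v c b "[]"]
      by (simp del: gen_map.simps)
  qed auto
qed

text \<open>The mirror image: \<open>b\<close> passes from left to right. Now the positive crossings
  act on the cable, and the negative ones act on \<open>b\<close> by inverse values in reversed
  order, whose product is \<open>inv (tuple_val G v)\<close>.\<close>

lemma word_map_cable_right:
  assumes "set v \<subseteq> trees G" "b \<in> trees G"
  shows "word_map G (map (Pair True) [1..<1 + length v]) (b # v) =
           map (tree_act G (tree_val G b)) v @ [b]"
    and "word_map G (map (Pair False) [1..<1 + length v]) (b # v) =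
           v @ [tree_act G (inv (tuple_val G v)) b]"
proof -
  have *: "word_map G (map (Pair e) [1..<1 + length v]) ((b # v) @ [c]) =
      word_map G (map (Pair e) [1..<1 + length v]) (b # v) @ [c]" for e b c and v :: "'a tree list"
    by (rule word_map_append2) auto
  show "word_map G (map (Pair True) [1..<1 + length v]) (b # v) =
           map (tree_act G (tree_val G b)) v @ [b]"
    using assms
  proof (induction v rule: rev_induct)
    case (snoc c v)
    then show ?case
      using *[of True v b c] gen_map_append(1)[of G "map (tree_act G (tree_val G b)) v" b c "[]"]
      by (simp del: gen_map.simps)
  qed auto
  show "word_map G (map (Pair False) [1..<1 + length v]) (b # v) =
           v @ [tree_act G (inv (tuple_val G v)) b]"
    using assms
  proof (induction v rule: rev_induct)
    case (snoc c v)
    then show ?case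
      using *[of False v b c] gen_map_append(2)[of G v "tree_act G (inv (tuple_val G v)) b" c "[]"]
      by (simp add: inv_mult_group tree_act_mult del: gen_map.simps)
  qed auto
qed

text \<open>Cases on where the crossing lies relative to the cable. Away from it, only indices
  shift. Where the cable acts on its neighbour \<open>b\<close>, the equation
  \<open>tuple_val G v = tree_val G a\<close> is used; where \<open>b\<close> acts on the cable,
  invariance of \<open>R\<close> replaces \<open>(v, a)\<close> by its translate.\<close>

lemma graft_gen:
  assumes R: "tuple_hom G m R" and xy: "(x, y) \<in> graft G n R i" and j: "1 \<le> j" "j < n"
  shows "(word_map G (word_subst [(e, j)] i m) x, gen_map G (e, j) y)
           \<in> graft G n R (word_perm [(e, j)] i)"
proof -
  obtain p v a q where x: "x = p @ v @ q" and y: "y = p @ a # q" and i: "i = Suc (length p)"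
    and va: "(v, a) \<in> R" and t: "p @ a # q \<in> tree_tuples G n"
    using xy by (auto simp: graft_def)
  note v = tuple_homD[OF R va]
  have n: "n = length p + 1 + length q" and pq: "set p \<subseteq> trees G" "set q \<subseteq> trees G"
    using t by (auto simp: tree_tuples_append)
  have c: "gen_map G (e, j) y \<in> tree_tuples G n"
    using gen_map_closed[OF j] t y by blast
  consider "i < j" | "i = j" | "i = j + 1" | "j + 1 < i" by linarith
  then show ?thesis
  proof cases
    case 1
    have "gen_map G (e, j) y = p @ a # gen_map G (e, j - i) q"
      using gen_map_append1[of "j - i" G e "p @ [a]" q] 1 by (simp add: i y del: gen_map.simps)
    \<comment> \<open>Since \<open>1 \<le> i\<close> and \<open>i < j\<close>, the subtraction does
      not truncate, so erasing the strand (\<open>m = 0\<close>) is covered.\<close>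
    moreover have "gen_map G (e, j + m - 1) x = p @ v @ gen_map G (e, j - i) q"
      using gen_map_append1[of "j - i" G e "p @ v" q] 1 v(1) by (simp add: i x add.commute del: gen_map.simps)
    ultimately show ?thesis
      using 1 c graftI[OF i va, of "gen_map G (e, j - i) q"] i by (simp del: gen_map.simps)
  next
    case 4
    have "gen_map G (e, j) y = gen_map G (e, j) p @ a # q"
      using gen_map_append2[of j p G e "a # q"] 4 j by (simp add: i y del: gen_map.simps)
    moreover have "gen_map G (e, j) x = gen_map G (e, j) p @ v @ q"
      using gen_map_append2[of j p G e "v @ q"] 4 j by (simp add: i x del: gen_map.simps)
    ultimately show ?thesis
      using 4 c graftI[OF _ va, of i "gen_map G (e, j) p" q] i by (simp del: gen_map.simps)
  next
    case 2
    then obtain b r where q: "q = b # r" using n j i by (cases q) auto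
    have b: "b \<in> trees G" using pq q by auto
    have w: "word_map G (word_subst [(e, j)] i m) x =
        p @ word_map G (map (Pair e) (rev [1..<1 + length v])) (v @ [b]) @ r"
      using word_map_block(1)[of "v @ [b]" m G e p r] 2 i v(1)
      by (simp add: x q del: upt_Suc flip: add_Suc)
    show ?thesis
    proof (cases e)
      case True
      have g: "gen_map G (e, j) y = (p @ [tree_act G (tree_val G a) b]) @ a # r"
        using gen_map_append(1)[of G p a b r] True 2 i by (simp add: y q del: gen_map.simps)
      show ?thesis
        using graftI[of "Suc j" "p @ [tree_act G (tree_val G a) b]" v a R r G n] va c g w v b 2 i True
          word_map_cable_left(1)[OF v(2) b]
        by (simp del: gen_map.simps word_subst.simps upt_Suc)
    next
      case False
      let ?h = "inv (tree_val G b)"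
      have g: "gen_map G (e, j) y = (p @ [b]) @ tree_act G ?h a # r"
        using gen_map_append(2)[of G p a b r] False 2 i by (simp add: y q del: gen_map.simps)
      show ?thesis
        using graftI[of "Suc j" "p @ [b]" "map (tree_act G ?h) v" "tree_act G ?h a" R r G n]
          v(6)[of ?h] c g w v(1,2) b 2 i False word_map_cable_left(2)[OF v(2) b]
        by (simp del: gen_map.simps word_subst.simps upt_Suc)
    qed
  next
    case 3
    then obtain b r where p: "p = r @ [b]" using j i by (cases p rule: rev_cases) auto
    have b: "b \<in> trees G" using pq p by auto
    have j': "j = Suc (length r)" using 3 i p by simp
    have w: "word_map G (word_subst [(e, j)] i m) x =
        r @ word_map G (map (Pair e) [1..<1 + length v]) (b # v) @ q"
      using word_map_block(2)[of "b # v" m G e r q] 3 j' v(1)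
      by (simp add: x p del: upt_Suc flip: add_Suc)
    show ?thesis
    proof (cases e)
      case True
      let ?h = "tree_val G b"
      have g: "gen_map G (e, j) y = r @ tree_act G ?h a # b # q"
        using gen_map_append(1)[of G r b a q] True j' by (simp add: y p del: gen_map.simps)
      show ?thesis
        using graftI[of j r "map (tree_act G ?h) v" "tree_act G ?h a" R "b # q" G n]
          v(6)[of ?h] c g w v(1,2) b 3 j' True word_map_cable_right(1)[OF v(2) b]
        by (simp del: gen_map.simps word_subst.simps upt_Suc)
    next
      case False
      have g: "gen_map G (e, j) y = r @ a # tree_act G (inv (tree_val G a)) b # q"
        using gen_map_append(2)[of G r b a q] False j' by (simp add: y p del: gen_map.simps)
      show ?thesis
        using graftI[of j r v a R "tree_act G (inv (tree_val G a)) b # q" G n] va c g w v b 3 j' False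
          word_map_cable_right(2)[OF v(2) b]
        by (simp del: gen_map.simps word_subst.simps upt_Suc)
    qed
  qed
qed

text \<open>Letter by letter, with \<open>word_perm\<close> following the position of the
  cable.\<close>

lemma graft_word:
  assumes R: "tuple_hom G m R"
  shows "w \<in> bwords n \<Longrightarrow> (x, y) \<in> graft G n R i \<Longrightarrow>
     (word_map G (word_subst w i m) x, word_map G w y) \<in> graft G n R (word_perm w i)"
proof (induction w arbitrary: x y i)
  case (Cons l w)
  obtain e j where l: "l = (e, j)" by (cases l)
  then have "1 \<le> j" "j < n" and w: "w \<in> bwords n" using Cons.prems by auto
  from Cons.IH[OF w graft_gen[OF R Cons.prems(2) this(1,2), of e]] show ?case
    using word_subst_append[of "[l]" w i m]
    by (simp add: l del: gen_map.simps word_subst.simps upt_Suc)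
qed simp

text \<open>Apply \<open>graft_word\<close> to the inverse braid, which is legitimate because cabling respects the
  braid relations.\<close>

lemma graft_word_converse:
  assumes R: "tuple_hom G m R" and w: "w \<in> bwords n" and i: "i \<in> {1..n}"
    and x: "x \<in> tree_tuples G (n + m - 1)"
    and z: "(word_map G (word_subst w i m) x, z) \<in> graft G n R (word_perm w i)"
  shows "\<exists>y. (x, y) \<in> graft G n R i \<and> z = word_map G w y"
proof (intro exI conjI)
  let ?v = "word_inv w"
  have v: "?v \<in> bwords n" using w by simp
  \<comment> \<open>Cabling \<open>w\<close> followed by its inverse gives a word equal to the empty
    one, so the cabled inverse undoes the cabled \<open>w\<close> on \<open>x\<close>.\<close>
  have "word_map G (word_subst (w @ ?v) i m) x = word_map G (word_subst [] i m) x"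
    by (rule word_map_braid_eq[OF word_subst_braid_eq[OF braid_eq_inv_right[OF w] i] x])
  then have "word_map G (word_subst ?v (word_perm w i) m) (word_map G (word_subst w i m) x) = x"
    by (simp only: word_subst_append word_map_append word_subst.simps word_map.simps)
  then show "(x, word_map G ?v z) \<in> graft G n R i"
    using graft_word[OF R v z] by (simp only: word_perm_inv(1)[OF w])
  show "z = word_map G w (word_map G ?v z)"
    using word_map_braid_eq[OF braid_eq_inv_left[OF w] graft_tuples(2)[OF R z]] by simp
qed

text \<open>Going right to left in the equation, \<open>graft_word\<close> transports a related pair
  along \<open>w\<close>. In the other direction the pair is known only after \<open>w\<close> and
  is pulled back by \<open>graft_word_converse\<close>.\<close>

lemma graft_natural:
  assumes R: "tuple_hom G m R" and w: "w \<in> bwords n" and i: "i \<in> {1..n}"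
  shows "word_interp G (n + m - 1) (word_subst w i m) O graft G n R (word_perm w i) =
           graft G n R i O word_interp G n w"
proof (intro equalityI subrelI, goal_cases)
  case (1 x z)
  then have x: "x \<in> tree_tuples G (n + m - 1)"
    and z: "(word_map G (word_subst w i m) x, z) \<in> graft G n R (word_perm w i)"
    unfolding word_interp_eq[OF word_subst_bwords[OF w i]] by blast+
  obtain y where y: "(x, y) \<in> graft G n R i" "z = word_map G w y"
    using graft_word_converse[OF R w i x z] by blast
  then have "(y, z) \<in> word_interp G n w"
    using graft_tuples(2)[OF R y(1)] unfolding word_interp_eq[OF w] by blast
  with y(1) show ?case by (rule relcompI)
next
  case (2 x z)
  then obtain y where y: "(x, y) \<in> graft G n R i" "z = word_map G w y"
    unfolding word_interp_eq[OF w] by blast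
  have "(x, word_map G (word_subst w i m) x) \<in> word_interp G (n + m - 1) (word_subst w i m)"
    using graft_tuples(1)[OF R y(1)] unfolding word_interp_eq[OF word_subst_bwords[OF w i]] by blast
  moreover have "(word_map G (word_subst w i m) x, z) \<in> graft G n R (word_perm w i)"
    using graft_word[OF R w y(1)] y(2) by simp
  ultimately show ?case by (rule relcompI)
qed

end

section \<open>Braids\<close>

lemma strands_braid_of [simp]: "strands (braid_of n w) = n"
  by transfer simp

text \<open>Choice of a representing word, through which the later facts about braids reduce to
  words.\<close>

lemma braid_of_cases:
  obtains w where "w \<in> bwords (strands s)" "s = braid_of (strands s) w"
proof -
  have "\<exists>w. w \<in> bwords (strands s) \<and> s = braid_of (strands s) w"
    by transfer (force dest: braid_eq_bwords)
  then show ?thesis using that by blast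
qed

lemma braid_of_eq_iff:
  "v \<in> bwords n \<Longrightarrow> w \<in> bwords n \<Longrightarrow> braid_of n v = braid_of n w \<longleftrightarrow> braid_eq n v w"
  by transfer simp

lemma braid_id_eq: "braid_id n = braid_of n []"
  by transfer (simp add: braid_eq_Nil)

lemma strands_braid_id [simp]: "strands (braid_id n) = n"
  by (simp add: braid_id_eq)

lemma braid_mult_of:
  "v \<in> bwords n \<Longrightarrow> w \<in> bwords n \<Longrightarrow> braid_mult (braid_of n v) (braid_of n w) = braid_of n (v @ w)"
  by transfer (simp add: braid_eq.refl)

lemma braid_tensor_of:
  "v \<in> bwords n \<Longrightarrow> w \<in> bwords m \<Longrightarrow>
     braid_tensor (braid_of n v) (braid_of m w) = braid_of (n + m) (v @ word_shift n w)"
  by transfer (auto intro!: braid_eq.refl intro: bwords_shift bwords_mono)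

lemma braid_perm_of: "w \<in> bwords n \<Longrightarrow> braid_perm (braid_of n w) = word_perm w"
  by transfer simp

lemma braid_subst_of:
  "w \<in> bwords n \<Longrightarrow> i \<in> {1..n} \<Longrightarrow>
     braid_subst (braid_of n w) i m = braid_of (n + m - 1) (word_subst w i m)"
  by transfer (auto intro!: braid_eq.refl word_subst_bwords[simplified] dest: word_subst_bwords[simplified])

lemma bij_braid_perm: "bij (braid_perm s)"
proof -
  obtain w where w: "w \<in> bwords (strands s)" "s = braid_of (strands s) w"
    by (rule braid_of_cases)
  then have "braid_perm s = word_perm w" using braid_perm_of by metis
  then show ?thesis using word_perm_inv[OF w(1)] by (metis bijI')
qed

lemma braid_perm_range: "i \<in> {1..strands s} \<Longrightarrow> braid_perm s i \<in> {1..strands s}"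
  by (metis braid_of_cases braid_perm_of word_perm_range)

lemma inv_braid_perm_range:
  assumes "i \<in> {1..strands s}"
  shows "inv_into UNIV (braid_perm s) i \<in> {1..strands s}"
proof -
  obtain w where w: "w \<in> bwords (strands s)" "s = braid_of (strands s) w"
    by (rule braid_of_cases)
  then have "braid_perm s (word_perm (word_inv w) i) = i" using braid_perm_of word_perm_inv by metis
  then have "inv_into UNIV (braid_perm s) i = word_perm (word_inv w) i"
    by (metis bij_braid_perm bij_inv_eq_iff)
  then show ?thesis using word_perm_range[of "word_inv w" "strands s" i] w assms by simp
qed

context group
begin

text \<open>The union over all representing words collapses, since equal braids act equally by
  \<open>word_map_braid_eq\<close>.\<close>

lemma braid_interp_of:
  assumes "w \<in> bwords n"
  shows "braid_interp G (braid_of n w) = {(u, word_map G w u) | u. u \<in> tree_tuples G n}"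
proof -
  have "word_interp G n v = word_interp G n w" if "v \<in> bwords n" "braid_of n v = braid_of n w" for v
  proof -
    have "braid_eq n v w" using that assms braid_of_eq_iff by blast
    then have "word_map G v u = word_map G w u" if "u \<in> tree_tuples G n" for u
      using word_map_braid_eq that by blast
    then show ?thesis unfolding word_interp_eq[OF that(1)] word_interp_eq[OF assms] by auto
  qed
  then have "braid_interp G (braid_of n w) = word_interp G n w"
    using assms unfolding braid_interp_def strands_braid_of by blast
  then show ?thesis using word_interp_eq[OF assms] by simp
qed

lemma braid_interp_id: "braid_interp G (braid_id n) = Id_on (tree_tuples G n)"
  using braid_interp_of[of "[]" n] by (auto simp: braid_id_eq)

lemma braid_interp_mult:
  assumes "strands s = strands s'"
  shows "braid_interp G (braid_mult s s') = braid_interp G s O braid_interp G s'"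
proof -
  define n where "n = strands s'"
  obtain v where v: "v \<in> bwords n" "s = braid_of n v"
    using braid_of_cases[of s] assms n_def by metis
  obtain w where w: "w \<in> bwords n" "s' = braid_of n w"
    using braid_of_cases[of s'] n_def by metis
  show ?thesis
    using word_map_closed[OF v(1)]
    by (auto simp: v(2) w(2) braid_mult_of[OF v(1) w(1)] braid_interp_of v(1) w(1) relcomp_unfold)
qed

lemma braid_interp_tensor:
  "braid_interp G (braid_tensor s s') =
     {(u @ v, u' @ v') | u v u' v'. (u, u') \<in> braid_interp G s \<and> (v, v') \<in> braid_interp G s'}"
proof -
  define n m where nm: "n = strands s" "m = strands s'"
  obtain v where v: "v \<in> bwords n" "s = braid_of n v"
    using braid_of_cases[of s] nm by metis
  obtain w where w: "w \<in> bwords m" "s' = braid_of m w"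
    using braid_of_cases[of s'] nm by metis
  have vw: "v @ word_shift n w \<in> bwords (n + m)"
    using bwords_shift[OF w(1)] bwords_mono[OF v(1)] by simp
  have *: "word_map G (v @ word_shift n w) (x @ y) = word_map G v x @ word_map G w y"
    if "length x = n" for x y
  proof -
    have "\<forall>(e, i)\<in>set w. 1 \<le> i" using w(1) by (auto simp: bwords_def)
    then show ?thesis
      using word_map_shift[of w G "word_map G v x" y] word_map_append2[of v x G y] v(1) that by simp
  qed
  note int = braid_interp_of[OF v(1)] braid_interp_of[OF w(1)] braid_interp_of[OF vw]
  show ?thesis
    unfolding v(2) w(2) braid_tensor_of[OF v(1) w(1)] int
  proof (intro equalityI subsetI, goal_cases)
    case (1 z)
    then obtain u where u: "z = (u, word_map G (v @ word_shift n w) u)" "u \<in> tree_tuples G (n + m)"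
      by blast
    \<comment> \<open>The tuple is cut after the \<open>n\<close> strands of \<open>s\<close>; the
      shifted word of \<open>s'\<close> acts on the remainder only.\<close>
    define x y where "x = take n u" and "y = drop n u"
    then have "u = x @ y" "x \<in> tree_tuples G n" "y \<in> tree_tuples G m"
      using u(2) by (auto simp: tree_tuples_def dest: in_set_takeD in_set_dropD)
    moreover from this have "z = (x @ y, word_map G v x @ word_map G w y)"
      using u(1) * tree_tuplesD(1) by metis
    ultimately show ?case by blast
  next
    case (2 z)
    then obtain x y where z: "z = (x @ y, word_map G v x @ word_map G w y)"
      and xy: "x \<in> tree_tuples G n" "y \<in> tree_tuples G m"
      by blast
    then have "z = (x @ y, word_map G (v @ word_shift n w) (x @ y))"
      using * tree_tuplesD(1) by metis
    moreover have "x @ y \<in> tree_tuples G (n + m)"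
      using xy by (auto simp: tree_tuples_def)
    ultimately show ?case by blast
  qed
qed

lemma braid_interpD:
  assumes "(u, u') \<in> braid_interp G s"
  shows "u \<in> tree_tuples G (strands s)" "u' \<in> tree_tuples G (strands s)"
    "tuple_val G u' = tuple_val G u"
    "g \<in> carrier G \<Longrightarrow> (map (tree_act G g) u, map (tree_act G g) u') \<in> braid_interp G s"
proof -
  define n where "n = strands s"
  obtain w where w: "w \<in> bwords n" "s = braid_of n w"
    using braid_of_cases[of s] n_def by metis
  have u: "u \<in> tree_tuples G n" "u' = word_map G w u"
    using assms w by (auto simp: braid_interp_of)
  show "u \<in> tree_tuples G (strands s)" "u' \<in> tree_tuples G (strands s)"
    "tuple_val G u' = tuple_val G u"
    using u w(1) word_map_closed word_map_val by (auto simp: n_def)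
  show "(map (tree_act G g) u, map (tree_act G g) u') \<in> braid_interp G s" if "g \<in> carrier G"
    using u w(1) word_map_act[OF w(1) u(1) that] tuple_act_closed[OF that u(1)]
    by (auto simp: w(2) braid_interp_of)
qed

text \<open>Naturality at the level of braids, in the shape needed for the \<open>Braid\<close> case
  of \<open>interp_subst\<close>: \<open>i\<close> will be the preimage of the position of the
  variable.\<close>

lemma braid_interp_subst:
  assumes "tuple_hom G m R" and "i \<in> {1..strands s}"
  shows "braid_interp G (braid_subst s i m) O graft G (strands s) R (braid_perm s i) =
           graft G (strands s) R i O braid_interp G s"
proof -
  define n where "n = strands s"
  obtain w where w: "w \<in> bwords n" "s = braid_of n w"
    using braid_of_cases[of s] n_def by metis
  then show ?thesis
    using graft_natural[OF assms(1) w(1), of i] assms(2) word_subst_bwords[OF w(1), of i m]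
    by (simp add: braid_subst_of braid_perm_of braid_interp_of word_interp_eq)
qed

end

section \<open>Terms\<close>

lemma position_eqI: "distinct xs \<Longrightarrow> k < length xs \<Longrightarrow> position (xs ! k) xs = Suc k"
proof (induction xs arbitrary: k)
  case (Cons x xs)
  then show ?case by (cases k) (auto simp: position_def)
qed simp

lemma position_append:
  "position x (xs @ ys) = (if x \<in> set xs then position x xs else length xs + position x ys)"
  by (induction xs) (auto simp: position_def)

lemma position_range: "x \<in> set xs \<Longrightarrow> position x xs \<in> {1..length xs}"
  by (induction xs) (auto simp: position_def)

lemma nth_position: "x \<in> set xs \<Longrightarrow> xs ! (position x xs - 1) = x"
  by (induction xs) (auto simp: position_def)

lemma length_permute_ctx [simp]: "length (permute_ctx s xs) = length xs"
  by (simp add: permute_ctx_def del: upt_Suc)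

lemma nth_permute_ctx:
  "k < length xs \<Longrightarrow> permute_ctx s xs ! k = xs ! (braid_perm s (Suc k) - 1)"
  by (simp add: permute_ctx_def del: upt_Suc)

lemma distinct_permute_ctx:
  assumes "distinct xs" "strands s = length xs"
  shows "distinct (permute_ctx s xs)"
proof -
  have "inj_on (\<lambda>i. xs ! (braid_perm s i - 1)) {1..length xs}"
  proof (rule inj_onI)
    fix i j assume ij: "i \<in> {1..length xs}" "j \<in> {1..length xs}"
      and eq: "xs ! (braid_perm s i - 1) = xs ! (braid_perm s j - 1)"
    have r: "braid_perm s i \<in> {1..length xs}" "braid_perm s j \<in> {1..length xs}"
      using ij braid_perm_range[of _ s] assms(2) by auto
    then have "braid_perm s i = braid_perm s j"
      using eq nth_eq_iff_index_eq[OF assms(1), of "braid_perm s i - 1" "braid_perm s j - 1"] by force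
    then show "i = j" using bij_braid_perm[of s] by (simp add: bij_def inj_eq)
  qed
  moreover have "set [1..<length xs + 1] = {1..length xs}" by auto
  ultimately show ?thesis unfolding permute_ctx_def by (simp add: distinct_map del: upt_Suc)
qed

text \<open>Entry \<open>j\<close> of the permuted context is entry \<open>braid_perm s j\<close> of
  \<open>xs\<close>. Hence the strand that \<open>subst\<close> cables is the one at which
  \<open>x\<close> stands in the context of the braided term.\<close>

lemma position_permute_ctx:
  assumes "distinct xs" "strands s = length xs" "x \<in> set xs"
  shows "position x (permute_ctx s xs) = inv_into UNIV (braid_perm s) (position x xs)"
    (is "_ = ?j")
proof -
  have j: "?j \<in> {1..length xs}"
    using inv_braid_perm_range[of _ s] position_range[OF assms(3)] assms(2) by simp
  have "braid_perm s ?j = position x xs"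
    using bij_braid_perm by (metis bij_inv_eq_iff)
  then have "permute_ctx s xs ! (?j - 1) = x"
    using j nth_position[OF assms(3)] nth_permute_ctx[of "?j - 1" xs s] by fastforce
  then show ?thesis
    using position_eqI[OF distinct_permute_ctx[OF assms(1,2)], of "?j - 1"] j by fastforce
qed

lemma set_permute_ctx:
  assumes "distinct xs" "strands s = length xs"
  shows "set (permute_ctx s xs) = set xs"
proof (rule card_subset_eq)
  show "set (permute_ctx s xs) \<subseteq> set xs"
  proof
    fix x assume "x \<in> set (permute_ctx s xs)"
    then obtain k where "k < length xs" "x = xs ! (braid_perm s (Suc k) - 1)"
      by (auto simp: in_set_conv_nth nth_permute_ctx)
    then show "x \<in> set xs" using braid_perm_range[of "Suc k" s] assms(2) by auto
  qed
  show "card (set (permute_ctx s xs)) = card (set xs)"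
    using assms distinct_permute_ctx[OF assms] by (simp add: distinct_card)
qed simp

lemma judgement_ctx: "\<Gamma> \<turnstile> M \<Longrightarrow> distinct \<Gamma> \<and> ctx M = \<Gamma>"
  by (induction rule: judgement.induct) (auto simp: distinct_permute_ctx)

lemma is_term_iff: "is_term M \<longleftrightarrow> ctx M \<turnstile> M"
  using judgement_ctx by (auto simp: is_term_def)

inductive_cases judgement_LamE: "\<Gamma> \<turnstile> Lam x M"
inductive_cases judgement_AppE: "\<Gamma> \<turnstile> App M N"
inductive_cases judgement_BraidE: "\<Gamma> \<turnstile> Braid s M"

lemma is_term_Lam: "is_term (Lam x M) \<Longrightarrow> is_term M \<and> (\<exists>\<Gamma>. ctx M = \<Gamma> @ [x])"
  by (meson is_term_def judgement_LamE judgement_ctx)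

lemma is_term_App: "is_term (App M N) \<Longrightarrow> is_term M \<and> is_term N"
  by (meson is_term_def judgement_AppE)

lemma is_term_Braid: "is_term (Braid s M) \<Longrightarrow> is_term M \<and> strands s = length (ctx M)"
  by (metis is_term_def judgement_BraidE judgement_ctx)

lemma interp_rename: "interp G (rename x y M) = interp G M"
  by (induction M) auto

text \<open>By linearity a variable is free in one factor of an application only; this keeps the
  other factor fixed.\<close>

lemma subst_fresh: "\<Gamma> \<turnstile> M \<Longrightarrow> x \<notin> set \<Gamma> \<Longrightarrow> subst M x N = M"
proof (induction rule: judgement.induct)
  case (Braid \<Gamma> M s)
  then show ?case using judgement_ctx[OF Braid.hyps(1)] by (simp add: set_permute_ctx)
qed auto

section \<open>Terms as morphisms, the substitution lemma, soundness\<close>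

context group
begin

text \<open>For an abstraction, \<open>|u||a| = |b|\<close> gives \<open>|u| = |b||a|^-1\<close>,
  the value of the node. For an application, \<open>|u||v| = |b||a|^-1 |a| = |b|\<close>. Braids
  preserve the valuation and commute with the action.\<close>

lemma interp_hom: "\<Gamma> \<turnstile> M \<Longrightarrow> tuple_hom G (length \<Gamma>) (interp G M)"
proof (induction rule: judgement.induct)
  case (Var x)
  then show ?case by (auto simp: tuple_hom_def tree_tuples_def)
next
  case (Lam \<Gamma> x M)
  show ?case
  proof (rule tuple_homI, goal_cases)
    case (1 u c)
    then obtain a b where c: "c = b \<leftarrow> a" and ab: "(u @ [a], b) \<in> interp G M" by auto
    note M = tuple_homD[OF Lam.IH ab]
    have "tree_val G b = tuple_val G u \<otimes> tree_val G a"
      using M(2,5) by simp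
    then have "tuple_val G u = tree_val G c"
      using M(2) by (simp add: m_assoc c)
    moreover have "(map (tree_act G g) u, tree_act G g c) \<in> interp G (Lam x M)"
      if "g \<in> carrier G" for g
      using M(6)[OF that] by (simp add: c)
    ultimately show ?case using M(1,2,4) by (simp add: tree_tuples_def c)
  qed
next
  case (App \<Gamma> M \<Delta> N)
  show ?case
  proof (rule tuple_homI, goal_cases)
    case (1 w b)
    then obtain u v a where w: "w = u @ v" and u: "(u, b \<leftarrow> a) \<in> interp G M" and v: "(v, a) \<in> interp G N"
      by auto
    note M = tuple_homD[OF App.IH(1) u] and N = tuple_homD[OF App.IH(2) v]
    have "tuple_val G w = tree_val G b"
      using M(2,4,5) N(2,4,5) by (simp add: m_assoc w)
    moreover have "(map (tree_act G g) w, tree_act G g b) \<in> interp G (App M N)"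
      if "g \<in> carrier G" for g
      using M(6)[OF that] N(6)[OF that] by (auto simp: w)
    ultimately show ?case using M(1,2,4) N(1,2) by (simp add: tree_tuples_append w)
  qed
next
  case (Braid \<Gamma> M s)
  show ?case
  proof (rule tuple_homI, goal_cases)
    case (1 u a)
    then obtain u' where u: "(u, u') \<in> braid_interp G s" and a: "(u', a) \<in> interp G M" by auto
    note s = braid_interpD[OF u] and M = tuple_homD[OF Braid.IH a]
    have "(map (tree_act G g) u, tree_act G g a) \<in> interp G (Braid s M)" if "g \<in> carrier G" for g
      using s(4)[OF that] M(6)[OF that] by auto
    then show ?case using s(1,3) M(4,5) Braid.hyps(2) by simp
  qed
qed

text \<open>The condition in \<open>graft\<close> that the middle tuple consists of \<open>n\<close>
  trees disappears, as \<open>S\<close> relates only such tuples.\<close>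

lemma graft_comp_iff:
  assumes "tuple_hom G n S"
  shows "(w, b) \<in> graft G n R i O S \<longleftrightarrow>
    (\<exists>p v a q. w = p @ v @ q \<and> i = Suc (length p) \<and> (v, a) \<in> R \<and> (p @ a # q, b) \<in> S)"
  using tuple_homD(3)[OF assms] unfolding graft_def relcomp_unfold by blast

text \<open>For abstractions: the last entry \<open>c\<close> belongs to the bound variable, and
  \<open>i \<le> n\<close> keeps the graft away from it.\<close>

lemma graft_comp_snoc_iff:
  assumes S: "tuple_hom G (Suc n) S" and i: "i \<le> n"
  shows "(u @ [c], b) \<in> graft G (Suc n) R i O S \<longleftrightarrow>
    (\<exists>p v a q. u = p @ v @ q \<and> i = Suc (length p) \<and> (v, a) \<in> R \<and> (p @ a # q @ [c], b) \<in> S)"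
    (is "?l \<longleftrightarrow> ?r")
proof
  assume ?l
  then obtain p v a q where *: "u @ [c] = p @ v @ q" "i = Suc (length p)" "(v, a) \<in> R" "(p @ a # q, b) \<in> S"
    unfolding graft_comp_iff[OF S] by blast
  have "q \<noteq> []" using tuple_homD(1)[OF S *(4)] *(2) i by auto
  then obtain r d where "q = r @ [d]" by (cases q rule: rev_cases) auto
  then have "u = p @ v @ r" "q = r @ [c]" using *(1) by simp_all
  then show ?r using *(2-4) by blast
next
  assume ?r
  then obtain p v a q where *: "u = p @ v @ q" "i = Suc (length p)" "(v, a) \<in> R" "(p @ a # q @ [c], b) \<in> S"
    by blast
  have "u @ [c] = p @ v @ (q @ [c])" using *(1) by simp
  then show ?l unfolding graft_comp_iff[OF S] using *(2-4) by blast
qed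

lemma interp_App_iff:
  "(w, b) \<in> interp G (App M N) \<longleftrightarrow>
     (\<exists>u v a. w = u @ v \<and> (u, b \<leftarrow> a) \<in> interp G M \<and> (v, a) \<in> interp G N)"
  by auto

text \<open>The work is in matching two decompositions of one tuple, around the grafted entry and
  between the two factors.\<close>

lemma interp_subst_App_left:
  assumes M: "\<Gamma> \<turnstile> M" and MN: "tuple_hom G n (interp G (App M N))"
    and M': "interp G M' = graft G (length \<Gamma>) R i O interp G M" and i: "i \<le> length \<Gamma>"
  shows "interp G (App M' N) = graft G n R i O interp G (App M N)"
proof (intro equalityI subrelI)
  fix w b
  note M'_iff = graft_comp_iff[OF interp_hom[OF M], of _ _ R i, folded M']
  {
    assume "(w, b) \<in> interp G (App M' N)"
    then obtain u u' a where w: "w = u @ u'" and u: "(u, b \<leftarrow> a) \<in> interp G M'" "(u', a) \<in> interp G N"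
      unfolding interp_App_iff by blast
    then obtain p v c q where *: "u = p @ v @ q" "i = Suc (length p)" "(v, c) \<in> R"
        "(p @ c # q, b \<leftarrow> a) \<in> interp G M"
      unfolding M'_iff by blast
    have "w = p @ v @ (q @ u')" using w *(1) by simp
    moreover have "(p @ c # (q @ u'), b) \<in> interp G (App M N)"
      unfolding interp_App_iff using *(4) u(2) by (metis append_Cons append_assoc)
    ultimately show "(w, b) \<in> graft G n R i O interp G (App M N)"
      unfolding graft_comp_iff[OF MN] using *(2,3) by blast
  next
    assume "(w, b) \<in> graft G n R i O interp G (App M N)"
    then obtain p v c r u u' a where *: "w = p @ v @ r" "i = Suc (length p)" "(v, c) \<in> R"
        "p @ c # r = u @ u'" "(u, b \<leftarrow> a) \<in> interp G M" "(u', a) \<in> interp G N"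
      unfolding graft_comp_iff[OF MN] interp_App_iff by blast
    \<comment> \<open>As \<open>i \<le> length \<Gamma>\<close>, the grafted entry \<open>c\<close>
      lies inside \<open>u\<close>, the share of \<open>M\<close>.\<close>
    have "length p < length u" using tuple_homD(1)[OF interp_hom[OF M] *(5)] *(2) i by simp
    then obtain k where "length u = Suc (length p + k)"
      using less_imp_Suc_add by blast
    then have "take (length u) (p @ c # r) = p @ c # take k r" by simp
    then obtain q where u: "u = p @ c # q" using *(4) by simp
    then have r: "r = q @ u'" using *(4) by simp
    have "(p @ v @ q, b \<leftarrow> a) \<in> interp G M'"
      unfolding M'_iff using *(2,3,5) u by blast
    moreover have "w = (p @ v @ q) @ u'" using *(1) r by simp
    ultimately show "(w, b) \<in> interp G (App M' N)"
      unfolding interp_App_iff using *(6) by blast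
  }
qed

lemma interp_subst_App_right:
  assumes M: "\<Gamma> \<turnstile> M" and N: "\<Delta> \<turnstile> N" and MN: "tuple_hom G n (interp G (App M N))"
    and N': "interp G N' = graft G (length \<Delta>) R i O interp G N" and i: "1 \<le> i"
  shows "interp G (App M N') = graft G n R (length \<Gamma> + i) O interp G (App M N)"
proof (intro equalityI subrelI)
  fix w b
  note N'_iff = graft_comp_iff[OF interp_hom[OF N], of _ _ R i, folded N']
  {
    assume "(w, b) \<in> interp G (App M N')"
    then obtain u u' a where w: "w = u @ u'" and u: "(u, b \<leftarrow> a) \<in> interp G M" "(u', a) \<in> interp G N'"
      unfolding interp_App_iff by blast
    then obtain p v c q where *: "u' = p @ v @ q" "i = Suc (length p)" "(v, c) \<in> R"
        "(p @ c # q, a) \<in> interp G N"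
      unfolding N'_iff by blast
    have "w = (u @ p) @ v @ q" using w *(1) by simp
    moreover have "length \<Gamma> + i = Suc (length (u @ p))"
      using *(2) tuple_homD(1)[OF interp_hom[OF M] u(1)] by simp
    moreover have "((u @ p) @ c # q, b) \<in> interp G (App M N)"
      unfolding interp_App_iff using *(4) u(1) by (metis append_assoc)
    ultimately show "(w, b) \<in> graft G n R (length \<Gamma> + i) O interp G (App M N)"
      unfolding graft_comp_iff[OF MN] using *(3) by blast
  next
    assume "(w, b) \<in> graft G n R (length \<Gamma> + i) O interp G (App M N)"
    then obtain p v c q u u' a where *: "w = p @ v @ q" "length \<Gamma> + i = Suc (length p)" "(v, c) \<in> R"
        "p @ c # q = u @ u'" "(u, b \<leftarrow> a) \<in> interp G M" "(u', a) \<in> interp G N"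
      unfolding graft_comp_iff[OF MN] interp_App_iff by blast
    have u: "length u = length \<Gamma>" using tuple_homD(1)[OF interp_hom[OF M] *(5)] .
    \<comment> \<open>As \<open>1 \<le> i\<close>, the grafted entry lies beyond \<open>u\<close>,
      in the share of \<open>N\<close>.\<close>
    then have "length u \<le> length p" using *(2) i by simp
    then have "u = take (length u) p"
      using arg_cong[OF *(4), of "take (length u)"] by simp
    then obtain r where p: "p = u @ r" by (metis append_take_drop_id)
    then have u': "u' = r @ c # q" and r: "i = Suc (length r)" using *(2,4) u by simp_all
    have "(r @ v @ q, a) \<in> interp G N'"
      unfolding N'_iff using *(3,6) u' r by blast
    moreover have "w = u @ (r @ v @ q)" using *(1) p by simp
    ultimately show "(w, b) \<in> interp G (App M N')"
      unfolding interp_App_iff using *(5) by blast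
  }
qed

text \<open>Substitution is precomposition with a graft, by induction on the derivation of
  \<open>M\<close>. Abstraction appends an entry behind the graft, application grafts into one
  factor, and the braid case is naturality.\<close>

lemma interp_subst:
  assumes N: "\<Delta> \<turnstile> N"
  shows "\<Gamma> \<turnstile> M \<Longrightarrow> x \<in> set \<Gamma> \<Longrightarrow>
    interp G (subst M x N) = graft G (length \<Gamma>) (interp G N) (position x \<Gamma>) O interp G M"
proof (induction rule: judgement.induct)
  case (Var y)
  have N_trees: "a \<in> trees G" if "(u, a) \<in> interp G N" for u a
    using tuple_homD(4)[OF interp_hom[OF N] that] .
  have "graft G 1 (interp G N) 1 = {(v, [a]) | v a. (v, a) \<in> interp G N}"
    by (auto simp: graft_def tree_tuples_append N_trees)
  moreover have "{(v, [a]) | v a. (v, a) \<in> interp G N} O interp G (Var y) = interp G N"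
    using N_trees by (auto simp: relcomp_unfold)
  ultimately show ?case using Var by (simp add: position_def)
next
  case (Lam \<Gamma> y M)
  \<comment> \<open>\<open>x\<close> lies in \<open>\<Gamma>\<close>, and the context of the body,
    \<open>\<Gamma>\<close> followed by \<open>y\<close>, is distinct.\<close>
  have xy: "y \<noteq> x" using judgement_ctx[OF Lam.hyps] Lam.prems by auto
  have pos: "position x (\<Gamma> @ [y]) = position x \<Gamma>" "position x \<Gamma> \<le> length \<Gamma>"
    using Lam.prems position_range[OF Lam.prems] by (simp_all add: position_append)
  have IH: "interp G (subst M x N) = graft G (Suc (length \<Gamma>)) (interp G N) (position x \<Gamma>) O interp G M"
    using Lam.IH Lam.prems pos(1) by simp
  have M: "tuple_hom G (Suc (length \<Gamma>)) (interp G M)"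
    using interp_hom[OF Lam.hyps] by simp
  have Lam_iff: "(u, t) \<in> interp G (Lam y M') \<longleftrightarrow> (\<exists>a b. t = b \<leftarrow> a \<and> (u @ [a], b) \<in> interp G M')" for u t M'
    by auto
  have "(u, t) \<in> interp G (Lam y (subst M x N)) \<longleftrightarrow>
      (u, t) \<in> graft G (length \<Gamma>) (interp G N) (position x \<Gamma>) O interp G (Lam y M)" for u t
    unfolding Lam_iff IH graft_comp_snoc_iff[OF M pos(2)]
      graft_comp_iff[OF interp_hom[OF judgement.Lam[OF Lam.hyps]]] append.simps append_assoc
    by blast
  then show ?case unfolding subst.simps if_not_P[OF xy]
    by (intro equalityI subrelI) (simp_all only:)
next
  case (App \<Gamma> M \<Delta>' M')
  note MM' = interp_hom[OF judgement.App[OF App.hyps]]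
  show ?case
  proof (cases "x \<in> set \<Gamma>")
    case True
    then have "subst M' x N = M'"
      using App.hyps(2,3) subst_fresh by blast
    moreover have "position x (\<Gamma> @ \<Delta>') = position x \<Gamma>" "position x \<Gamma> \<le> length \<Gamma>"
      using True position_range[OF True] by (simp_all add: position_append)
    ultimately show ?thesis
      using interp_subst_App_left[OF App.hyps(1) MM' App.IH(1)[OF True]] by (simp only: subst.simps)
  next
    case False
    then have x: "x \<in> set \<Delta>'" using App.prems by simp
    from False have "subst M x N = M" using App.hyps(1) subst_fresh by blast
    moreover have "position x (\<Gamma> @ \<Delta>') = length \<Gamma> + position x \<Delta>'" "1 \<le> position x \<Delta>'"
      using False position_range[OF x] by (simp_all add: position_append)
    ultimately show ?thesis
      using interp_subst_App_right[OF App.hyps(1,2) MM' App.IH(2)[OF x]] by (simp only: subst.simps)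
  qed
next
  case (Braid \<Gamma> M s)
  have \<Gamma>: "distinct \<Gamma>" "ctx M = \<Gamma>" using judgement_ctx[OF Braid.hyps(1)] by auto
  have x: "x \<in> set \<Gamma>" using Braid.prems set_permute_ctx[OF \<Gamma>(1) Braid.hyps(2)] by blast
  define j where "j = inv_into UNIV (braid_perm s) (position x \<Gamma>)"
  have "position x \<Gamma> \<in> {1..strands s}"
    unfolding Braid.hyps(2) by (rule position_range[OF x])
  then have j: "j \<in> {1..strands s}" "braid_perm s j = position x \<Gamma>"
    unfolding j_def by (rule inv_braid_perm_range, simp add: surj_f_inv_f bij_is_surj bij_braid_perm)
  have N': "tuple_hom G (length (ctx N)) (interp G N)"
    using interp_hom[OF N] judgement_ctx[OF N] by simp
  have "interp G (subst (Braid s M) x N) =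
      (braid_interp G (braid_subst s j (length (ctx N))) O
         graft G (strands s) (interp G N) (braid_perm s j)) O interp G M"
    using x by (simp only: subst.simps interp.simps \<Gamma>(2) if_True Braid.IH[OF x] O_assoc j(2)
        Braid.hyps(2) flip: j_def)
  also have "\<dots> = graft G (strands s) (interp G N) j O interp G (Braid s M)"
    by (simp only: braid_interp_subst[OF N' j(1)] O_assoc interp.simps)
  finally show ?case
    using position_permute_ctx[OF \<Gamma>(1) Braid.hyps(2) x]
    by (simp only: length_permute_ctx Braid.hyps(2) j_def)
qed

lemma beta_axiom_sound:
  assumes "beta_axiom M N" "is_term M" "is_term N"
  shows "interp G M = interp G N"
  using assms
proof cases
  case (alpha y M x)
  then show ?thesis by (simp add: interp_rename)
next
  case (beta M N x)
  then have N: "ctx N \<turnstile> N" and M: "is_term (Lam x M)"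
    using is_term_App is_term_iff assms(2) by blast+
  obtain \<Gamma> where \<Gamma>: "\<Gamma> @ [x] \<turnstile> M" using is_term_Lam[OF M] by (auto simp: is_term_iff)
  have pos: "position x (\<Gamma> @ [x]) = Suc (length \<Gamma>)" using position_eqI[of "\<Gamma> @ [x]" "length \<Gamma>"] judgement_ctx[OF \<Gamma>] by simp
  note hom = interp_hom[OF \<Gamma>] and sub = interp_subst[OF N \<Gamma>, of x, unfolded pos]
  \<comment> \<open>The bound variable is last in the context of \<open>M\<close>, so both sides
    place a tuple for \<open>N\<close> at the end; injectivity of \<open>Node\<close> recovers
    \<open>a\<close> and \<open>b\<close> from the abstraction.\<close>
  have "interp G (App (Lam x M) N) = graft G (length (\<Gamma> @ [x])) (interp G N) (Suc (length \<Gamma>)) O interp G M"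
  proof (intro equalityI subrelI)
    fix w b assume "(w, b) \<in> interp G (App (Lam x M) N)"
    then obtain u v a where *: "w = u @ v @ []" "(u @ [a], b) \<in> interp G M" "(v, a) \<in> interp G N" by auto
    moreover have "Suc (length \<Gamma>) = Suc (length u)"
      using tuple_homD(1)[OF hom *(2)] by simp
    ultimately show "(w, b) \<in> graft G (length (\<Gamma> @ [x])) (interp G N) (Suc (length \<Gamma>)) O interp G M"
      unfolding graft_comp_iff[OF hom] by blast
  next
    fix w b
    assume "(w, b) \<in> graft G (length (\<Gamma> @ [x])) (interp G N) (Suc (length \<Gamma>)) O interp G M"
    then obtain p v a q where *: "w = p @ v @ q" "Suc (length \<Gamma>) = Suc (length p)" "(v, a) \<in> interp G N"
        "(p @ a # q, b) \<in> interp G M"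
      unfolding graft_comp_iff[OF hom] by blast
    moreover have "q = []" using *(2) tuple_homD(1)[OF hom *(4)] by simp
    ultimately show "(w, b) \<in> interp G (App (Lam x M) N)" by auto
  qed
  then show ?thesis using sub by (simp only: beta(1,2) set_append list.set Un_insert_right insert_iff simp_thms)
next
  case (braid_id n)
  then have "is_term N" "n = length (ctx N)"
    using assms(2) is_term_Braid by fastforce+
  then have "interp G N \<subseteq> tree_tuples G n \<times> trees G"
    using interp_hom by (auto simp: is_term_iff tuple_hom_def)
  then show ?thesis by (auto simp: braid_id braid_interp_id)
next
  case (braid_mult s s' M)
  then have "strands s = strands s'"
    using assms(2) is_term_Braid[of s "Braid s' M"] is_term_Braid[of s' M] by simp
  then show ?thesis by (simp add: braid_mult braid_interp_mult O_assoc)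
next
  case (braid_app s M s' N)
  then have t: "is_term (Braid s M)" "is_term (Braid s' N)" "is_term M" "is_term N"
    "strands s = length (ctx M)" "strands s' = length (ctx N)"
    using assms(2) is_term_App is_term_Braid by blast+
  show ?thesis (is "?l = ?r")
  proof
    show "?l \<subseteq> ?r" unfolding braid_app
      by (auto simp: braid_interp_tensor relcomp_unfold) blast
    show "?r \<subseteq> ?l"
    proof (rule subrelI)
      fix z b assume "(z, b) \<in> ?r"
      then obtain w where "(z, w) \<in> braid_interp G (braid_tensor s s')" and "(w, b) \<in> interp G (App M N)"
        unfolding braid_app interp.simps(4) by blast
      then obtain x y x' y' u v a where *: "z = x @ y" "(x, x') \<in> braid_interp G s"
          "(y, y') \<in> braid_interp G s'" "x' @ y' = u @ v" "(u, b \<leftarrow> a) \<in> interp G M" "(v, a) \<in> interp G N"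
        unfolding braid_interp_tensor interp_App_iff by blast
      \<comment> \<open>The braids cut the tuple by numbers of strands and the application cuts it
        by contexts; typing makes the two cuts agree.\<close>
      have "length x' = length u"
        using braid_interpD(2)[OF *(2)] tuple_homD(1)[OF interp_hom *(5)] t
        by (metis is_term_iff tree_tuplesD(1))
      then have "x' = u" "y' = v" using *(4) by auto
      then show "(z, b) \<in> ?l" unfolding braid_app using * by auto
    qed
  qed
next
  case (braid_lam s x M)
  then have "is_term M"
    using assms(3) is_term_Lam is_term_Braid by blast
  \<comment> \<open>The extra identity strand passes only labels in the group, so the entry of the
    bound variable must be known to be in \<open>trees G\<close>.\<close>
  then have trees: "a \<in> trees G" if "(u @ [a], b) \<in> interp G M" for u a b
    using tuple_homD(2)[OF interp_hom that] by (simp add: is_term_iff)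
  have "braid_interp G (braid_id 1) = {([a], [a]) | a. a \<in> trees G}"
    by (auto simp: braid_interp_id tree_tuples_def length_Suc_conv)
  then have tensor: "(u @ [a], w) \<in> braid_interp G (braid_tensor s (braid_id 1)) \<longleftrightarrow>
      a \<in> trees G \<and> (\<exists>u'. w = u' @ [a] \<and> (u, u') \<in> braid_interp G s)" for u a w
    by (auto simp: braid_interp_tensor)
  have "(u, t) \<in> interp G (Braid s (Lam x M)) \<longleftrightarrow>
      (u, t) \<in> interp G (Lam x (Braid (braid_tensor s (braid_id 1)) M))" for u t
  proof -
    have "(u, t) \<in> interp G (Braid s (Lam x M)) \<longleftrightarrow>
        (\<exists>b a u'. t = b \<leftarrow> a \<and> (u, u') \<in> braid_interp G s \<and> (u' @ [a], b) \<in> interp G M)"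
      by auto
    also have "\<dots> \<longleftrightarrow>
        (\<exists>b a w. t = b \<leftarrow> a \<and> (u @ [a], w) \<in> braid_interp G (braid_tensor s (braid_id 1)) \<and>
           (w, b) \<in> interp G M)"
      unfolding tensor using trees by blast
    also have "\<dots> \<longleftrightarrow> (u, t) \<in> interp G (Lam x (Braid (braid_tensor s (braid_id 1)) M))"
      by auto
    finally show ?thesis .
  qed
  then show ?thesis unfolding braid_lam by (intro equalityI subrelI) (simp_all only:)
qed

lemma beta_eq_sound: "M =\<^sub>\<beta> N \<Longrightarrow> interp G M = interp G N"
  by (induction rule: beta_eq.induct) (auto simp: beta_axiom_sound)

lemma eta_fails: "interp G (Lam y (App (Var x) (Var y))) \<noteq> interp G (Var x)"
proof -
  have "([Leaf \<one>], Leaf \<one>) \<in> interp G (Var x)" by simp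
  moreover have "([Leaf \<one>], Leaf \<one>) \<notin> interp G (Lam y (App (Var x) (Var y)))" by simp
  ultimately show ?thesis by blast
qed

end

theorem mainTheorem3:
  fixes G :: "('g, 'z) monoid_scheme"
  assumes "group G"
  shows
    "(crossed_G_set G (tree_crossed G) \<and>
      tree_phi G \<in> XRel_hom G (crossed_tensor G (tree_crossed G) (crossed_dual G (tree_crossed G)))
                     (tree_crossed G) \<and>
      tree_psi G \<in> XRel_hom G (tree_crossed G)
                     (crossed_tensor G (tree_crossed G) (crossed_dual G (tree_crossed G))) \<and>
      tree_phi G O tree_psi G =
        Id_on (pts (crossed_tensor G (tree_crossed G) (crossed_dual G (tree_crossed G)))))
     \<and>
     ((\<forall>\<Gamma> M. \<Gamma> \<turnstile> M \<longrightarrow>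
        interp G M \<subseteq> tree_tuples G (length \<Gamma>) \<times> trees G \<and>
        (\<forall>(u, a)\<in>interp G M. tuple_val G u = tree_val G a \<and>
           (\<forall>g\<in>carrier G. (map (tree_act G g) u, tree_act G g a) \<in> interp G M))) \<and>
      (\<forall>\<Gamma> M N. M =\<^sub>\<beta> N \<longrightarrow> \<Gamma> \<turnstile> M \<longrightarrow> \<Gamma> \<turnstile> N \<longrightarrow> interp G M = interp G N))
     \<and>
     (\<forall>x y. x \<noteq> y \<longrightarrow> interp G (Lam y (App (Var x) (Var y))) \<noteq> interp G (Var x))"
proof -
  interpret group G by fact
  show ?thesis
    using crossed_tree tree_phi_hom tree_psi_hom tree_phi_psi
      interp_hom[unfolded tuple_hom_def] beta_eq_sound eta_fails
    by (intro conjI allI impI) blast+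
qed

end
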